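(* Let $m\ge n$ be positive integers. The map $$\Psi^*:\mathrm{maxSpec}(\mathbb{K}[X])\to\mathrm{maxSpec}(\mathcal{T}_{n,m}),\qquad N_{\underline\alpha}\mapsto M_{\Psi(\underline\alpha)}$$ is continuous.
   Context: Let $\mathbb{K}$ be an algebraically closed field of characteristic zero. A semistandard Young tableau of partition shape $\lambda$ is a filling of the Ferrers diagram of $\lambda$ (English notation) with positive integers, strictly increasing down columns and weakly increasing from left to right along rows. For positive integers $m\ge n$, $\mathrm{SSYT}_m^n$ denotes the set of all semistandard Young tableaux of all partition shapes with at most $n$ rows and with entries in $\{1,\dots,m\}$ (including the empty tableau $\emptyset$). For $T$ of shape $\lambda$ and $T'$ of shape $\mu$, $T\star T'$ is the semistandard Young tableau of shape $\lambda+\mu$ obtained by horizontally concatenating the rows of $T$ and $T'$ and sorting the entries in each row in weakly increasing order. $(\mathrm{SSYT}_m^n,\star,\emptyset)$ is a commutative monoid, and the tableaux algebra $\mathcal{T}_{n,m}$ is its monoid algebra over $\mathbb{K}$. Let $G_{n,m}=\{T_1,\dots,T_d\}$ be the set of tableaux in $\mathrm{SSYT}_m^n$ with exactly one column; it generates $\mathcal{T}_{n,m}$. Every maximal ideal of $\mathcal{T}_{n,m}$ is of the form $M_{\underline t}=\langle T_1-t_1,\dots,T_d-t_d\rangle$ for a unique $\underline t\in\mathbb{K}^d$ satisfying $t_at_b=t_ct_e$ whenever $T_a\star T_b=T_c\star T_e$, and each such $\underline t$ gives a maximal ideal. Let $X=\{x^{(i)}_j:1\le i\le n,1\le j\le m\}$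 be commuting variables. The maximal ideals of $\mathbb{K}[X]$ are $N_{\underline\alpha}=\langle x_j^{(i)}-\alpha_{i,j}\rangle_{i,j}$ for $\underline\alpha=(\alpha_{i,j})\in\mathbb{K}^{nm}$. Define $\Psi:\mathbb{K}^{nm}\to\mathbb{K}^d$ by $\Psi(\underline\alpha)=(\widetilde{\mathrm{ev}}_{\underline\alpha}(T_1),\dots,\widetilde{\mathrm{ev}}_{\underline\alpha}(T_d))$, where $\widetilde{\mathrm{ev}}_{\underline\alpha}(T)=\prod_{i,j}\alpha_{i,j}^{\mathrm{wt}_j^{(i)}(T)}$ and $\mathrm{wt}_j^{(i)}(T)$ is the number of $j$'s in row $i$ of $T$; $\Psi(\underline\alpha)$ indexes a maximal ideal of $\mathcal{T}_{n,m}$. Maximal spectra carry the Zariski topology. *)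

theory Defs
  imports
    "HOL-Algebra.Ideal"
    "HOL-Analysis.Abstract_Topology"
    "HOL-Library.Poly_Mapping"
    "HOL-Computational_Algebra.Polynomial"
begin

section \<open>Semistandard Young tableaux\<close>

text \<open>A filling is the list of its rows, top to bottom; rows and columns of the diagram
  are aligned at the left.\<close>

definition is_ssyt :: "nat list list \<Rightarrow> bool" where
  "is_ssyt T \<longleftrightarrow>
     [] \<notin> set T \<and> sorted_wrt (\<ge>) (map length T) \<and>
     (\<forall>r\<in>set T. 0 \<notin> set r \<and> sorted r) \<and>
     (\<forall>i j. Suc i < length T \<longrightarrow> j < length (T ! Suc i) \<longrightarrow> T ! i ! j < T ! Suc i ! j)"

text \<open>Rows are numbered from 1; all other rows are empty.\<close>

definition row_of :: "nat list list \<Rightarrow> nat \<Rightarrow> nat list" where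
  "row_of T i = (if i \<in> {1..length T} then T ! (i - 1) else [])"

definition star_rows :: "nat list list \<Rightarrow> nat list list \<Rightarrow> nat list list" where
  "star_rows T U =
     map (\<lambda>i. sort (row_of T i @ row_of U i)) [1..<Suc (max (length T) (length U))]"

lemma length_star_rows [simp]: "length (star_rows T U) = max (length T) (length U)"
  by (simp add: star_rows_def del: upt_Suc)

lemma row_of_star_rows: "row_of (star_rows T U) i = sort (row_of T i @ row_of U i)"
proof (cases "i \<in> {1..max (length T) (length U)}")
  case True
  then show ?thesis
    by (subst row_of_def) (auto simp: star_rows_def simp del: upt_Suc)
next
  case False
  then show ?thesis
    by (auto simp: row_of_def)
qed

text \<open>Two consecutive rows \<open>r\<close>, \<open>s\<close> fit together; the second form is additive in the rows.\<close>

definition fits :: "nat list \<Rightarrow> nat list \<Rightarrow> bool" where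
  "fits r s \<longleftrightarrow> length s \<le> length r \<and> (\<forall>j<length s. r ! j < s ! j)"

lemma fits_iff_count:
  assumes "sorted r" "sorted s"
  shows "fits r s \<longleftrightarrow>
    (\<forall>k. length (filter (\<lambda>x. x \<le> k) s) \<le> length (filter (\<lambda>x. x < k) r))"
proof
  assume f: "fits r s"
  show "\<forall>k. length (filter (\<lambda>x. x \<le> k) s) \<le> length (filter (\<lambda>x. x < k) r)"
  proof
    fix k
    have "{i. i < length s \<and> s ! i \<le> k} \<subseteq> {i. i < length r \<and> r ! i < k}"
      using f by (auto simp: fits_def intro: less_le_trans)
    then show "length (filter (\<lambda>x. x \<le> k) s) \<le> length (filter (\<lambda>x. x < k) r)"
      unfolding length_filter_conv_card by (intro card_mono) auto
  qed
next
  assume c: "\<forall>k. length (filter (\<lambda>x. x \<le> k) s) \<le> length (filter (\<lambda>x. x < k) r)"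
  have key: "j < length r \<and> r ! j < s ! j" if j: "j < length s" for j
  proof (rule ccontr)
    assume n: "\<not> (j < length r \<and> r ! j < s ! j)"
    have "{..j} \<subseteq> {i. i < length s \<and> s ! i \<le> s ! j}"
      using j assms(2) by (auto simp: sorted_iff_nth_mono)
    then have "card {..j} \<le> card {i. i < length s \<and> s ! i \<le> s ! j}"
      by (intro card_mono) auto
    also have "\<dots> \<le> card {i. i < length r \<and> r ! i < s ! j}"
      using c by (simp add: length_filter_conv_card)
    also have "{i. i < length r \<and> r ! i < s ! j} \<subseteq> {..<j}"
    proof
      fix i assume "i \<in> {i. i < length r \<and> r ! i < s ! j}"
      then have i: "i < length r" "r ! i < s ! j" by auto
      show "i \<in> {..<j}"
      proof (rule ccontr)
        assume "i \<notin> {..<j}"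
        then have "j \<le> i" by simp
        with i assms(1) have "r ! j \<le> r ! i" "j < length r"
          by (auto simp: sorted_iff_nth_mono)
        with n i show False by simp
      qed
    qed
    then have "card {i. i < length r \<and> r ! i < s ! j} \<le> card {..<j}"
      by (intro card_mono) auto
    finally show False by simp
  qed
  have "length s \<le> length r"
  proof (rule ccontr)
    assume "\<not> length s \<le> length r"
    then have "length r < length s" by simp
    from key[OF this] show False by simp
  qed
  with key show "fits r s" by (simp add: fits_def)
qed

lemma fits_sort_append:
  assumes "sorted a" "sorted b" "sorted c" "sorted d" "fits a b" "fits c d"
  shows "fits (sort (a @ c)) (sort (b @ d))"
proof -
  have *: "length (filter P (sort xs)) = length (filter P xs)" for P and xs :: "nat list"
    by (metis mset_filter mset_sort size_mset)
  have "\<forall>k. length (filter (\<lambda>x. x \<le> k) b) \<le> length (filter (\<lambda>x. x < k) a)"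
    "\<forall>k. length (filter (\<lambda>x. x \<le> k) d) \<le> length (filter (\<lambda>x. x < k) c)"
    using assms fits_iff_count by auto
  then show ?thesis
    by (subst fits_iff_count) (auto simp: * add_mono)
qed

lemma row_of_0 [simp]: "row_of T 0 = []"
  by (simp add: row_of_def)

lemma row_of_Suc: "row_of T (Suc i) = (if i < length T then T ! i else [])"
  by (auto simp: row_of_def)

lemma is_ssyt_iff:
  "is_ssyt T \<longleftrightarrow> [] \<notin> set T \<and>
     (\<forall>i. 0 \<notin> set (row_of T (Suc i)) \<and> sorted (row_of T (Suc i)) \<and>
          fits (row_of T (Suc i)) (row_of T (Suc (Suc i))))"
proof -
  have 1: "(\<forall>r\<in>set T. 0 \<notin> set r \<and> sorted r) \<longleftrightarrow>
    (\<forall>i. 0 \<notin> set (row_of T (Suc i)) \<and> sorted (row_of T (Suc i)))"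
    by (auto simp: row_of_Suc all_set_conv_all_nth)
  have 2: "sorted_wrt (\<ge>) (map length T) \<longleftrightarrow>
      (\<forall>i. Suc i < length T \<longrightarrow> length (T ! Suc i) \<le> length (T ! i))"
    by (subst sorted_wrt_iff_nth_Suc_transp) (auto simp: transp_def)
  show ?thesis
    unfolding is_ssyt_def 1 2 by (auto simp: row_of_Suc fits_def)
qed

lemma is_ssyt_star_rows:
  assumes "is_ssyt T" "is_ssyt U"
  shows "is_ssyt (star_rows T U)"
proof -
  have T: "[] \<notin> set T" "\<And>i. 0 \<notin> set (row_of T (Suc i))" "\<And>i. sorted (row_of T (Suc i))"
     "\<And>i. fits (row_of T (Suc i)) (row_of T (Suc (Suc i)))"
    and U: "[] \<notin> set U" "\<And>i. 0 \<notin> set (row_of U (Suc i))" "\<And>i. sorted (row_of U (Suc i))"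
     "\<And>i. fits (row_of U (Suc i)) (row_of U (Suc (Suc i)))"
    using assms unfolding is_ssyt_iff by auto
  have "[] \<notin> set (star_rows T U)"
  proof
    assume "[] \<in> set (star_rows T U)"
    then obtain i where i: "i < max (length T) (length U)" "star_rows T U ! i = []"
      unfolding in_set_conv_nth by auto
    then have "sort (row_of T (Suc i) @ row_of U (Suc i)) = []"
      using row_of_star_rows[of T U "Suc i"] by (simp add: row_of_Suc)
    then have e: "row_of T (Suc i) = []" "row_of U (Suc i) = []"
      by (metis append_is_Nil_conv length_0_conv length_sort)+
    then show False
      using i T(1) U(1) by (auto simp: row_of_Suc less_max_iff_disj split: if_splits) (metis nth_mem)+
  qed
  then show ?thesis
    unfolding is_ssyt_iff row_of_star_rows using T U by (auto intro!: fits_sort_append)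
qed

lemma rows_eqI:
  assumes "[] \<notin> set T" "[] \<notin> set U" "\<And>i. row_of T i = row_of U i"
  shows "T = U"
proof -
  have *: "length A \<le> length B"
    if "[] \<notin> set A" "\<And>i. row_of A i = row_of B i" for A B
  proof (rule ccontr)
    assume "\<not> length A \<le> length B"
    then show False
      using that(2)[of "Suc (length B)"] that(1) nth_mem[of "length B" A] by (auto simp: row_of_Suc)
  qed
  have "length T = length U"
    using *[of T U] *[of U T] assms by simp
  then show ?thesis
  proof (rule nth_equalityI)
    fix i assume "i < length T"
    then show "T ! i = U ! i"
      using assms(3)[of "Suc i"] \<open>length T = length U\<close> by (simp add: row_of_Suc)
  qed
qed

typedef ssyt = "{T. is_ssyt T}"
  morphisms rows Abs_ssyt
  by (rule exI[of _ "[]"]) (simp add: is_ssyt_def)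

setup_lifting type_definition_ssyt

lift_definition row :: "ssyt \<Rightarrow> nat \<Rightarrow> nat list" is row_of .

lemma ssyt_eqI: "(\<And>i. row T i = row U i) \<Longrightarrow> T = U"
  by transfer (auto simp: is_ssyt_def intro: rows_eqI)

text \<open>The monoid of tableaux is written additively, with \<open>+\<close> for the product
  \<open>\<star>\<close> and \<open>0\<close> for the empty tableau, so that \<open>ssyt \<Rightarrow>\<^sub>0 'k\<close> is its monoid algebra.\<close>

instantiation ssyt :: comm_monoid_add
begin

lift_definition zero_ssyt :: ssyt is "[]"
  by (simp add: is_ssyt_def)

lift_definition plus_ssyt :: "ssyt \<Rightarrow> ssyt \<Rightarrow> ssyt" is star_rows
  by (rule is_ssyt_star_rows)

lemma row_plus: "row (T + U) i = sort (row T i @ row U i)"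
  by transfer (rule row_of_star_rows)

lemma row_zero [simp]: "row 0 i = []"
  by transfer (simp add: row_of_def)

lemma sorted_row: "sorted (row T i)"
  by (cases i; transfer; simp add: is_ssyt_iff)

instance
proof
  fix a b c :: ssyt
  show "a + b + c = a + (b + c)"
    by (rule ssyt_eqI) (auto simp: row_plus intro!: properties_for_sort)
  show "a + b = b + a"
    by (rule ssyt_eqI) (auto simp: row_plus intro!: properties_for_sort)
  show "0 + a = a"
    by (rule ssyt_eqI) (auto simp: row_plus sorted_row intro!: sort_key_id_if_sorted sorted_sort_id)
qed

end

definition SSYT :: "nat \<Rightarrow> nat \<Rightarrow> ssyt set" where
  "SSYT n m = {T. length (rows T) \<le> n \<and> (\<forall>r\<in>set (rows T). set r \<subseteq> {1..m})}"

definition one_column :: "nat \<Rightarrow> nat \<Rightarrow> ssyt set" where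
  "one_column n m = {T \<in> SSYT n m. rows T \<noteq> [] \<and> (\<forall>r\<in>set (rows T). length r = 1)}"

definition wt :: "ssyt \<Rightarrow> nat \<Rightarrow> nat \<Rightarrow> nat" where
  "wt T i j = count_list (row T i) j"

lemma SSYT_iff_row:
  "T \<in> SSYT n m \<longleftrightarrow> (\<forall>i>n. row T i = []) \<and> (\<forall>i. set (row T i) \<subseteq> {1..m})"
proof -
  have ne: "rows T ! i \<noteq> []" if "i < length (rows T)" for i
    using rows[of T] nth_mem[OF that] unfolding is_ssyt_def by auto
  have 1: "length (rows T) \<le> n \<longleftrightarrow> (\<forall>i>n. row T i = [])"
  proof
    assume "\<forall>i>n. row T i = []"
    then have "row T (Suc n) = []" by simp
    then show "length (rows T) \<le> n"
      using ne[of n] by (auto simp: row.rep_eq row_of_Suc not_less split: if_splits)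
  qed (auto simp: row.rep_eq row_of_def)
  have 2: "(\<forall>r\<in>set (rows T). set r \<subseteq> {1..m}) \<longleftrightarrow> (\<forall>i. set (row T i) \<subseteq> {1..m})"
  proof
    assume "\<forall>i. set (row T i) \<subseteq> {1..m}"
    then have "set (row T (Suc i)) \<subseteq> {1..m}" for i by blast
    then show "\<forall>r\<in>set (rows T). set r \<subseteq> {1..m}"
      unfolding row.rep_eq row_of_Suc all_set_conv_all_nth by (metis (full_types))
  qed (auto simp: row.rep_eq row_of_def)
  show ?thesis
    unfolding SSYT_def using 1 2 by simp
qed

lemma SSYT_zero: "0 \<in> SSYT n m"
  by (simp add: SSYT_iff_row)

lemma SSYT_plus: "T \<in> SSYT n m \<Longrightarrow> U \<in> SSYT n m \<Longrightarrow> T + U \<in> SSYT n m"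
  by (simp add: SSYT_iff_row row_plus)


section \<open>Monoid algebras\<close>

text \<open>\<open>'a \<Rightarrow>\<^sub>0 'k\<close> is the monoid algebra of the whole type \<open>'a\<close>, with product the convolution.
  The monoid algebra of a submonoid \<open>S\<close> consists of the elements supported in \<open>S\<close>.\<close>

definition monoid_algebra :: "'a::comm_monoid_add set \<Rightarrow> ('a \<Rightarrow>\<^sub>0 'k::comm_ring_1) ring" where
  "monoid_algebra S =
     \<lparr>carrier = {p. Poly_Mapping.keys p \<subseteq> S}, monoid.mult = (*), one = 1, zero = 0, add = (+)\<rparr>"

lemma cring_monoid_algebra:
  assumes "0 \<in> S" "\<And>a b. a \<in> S \<Longrightarrow> b \<in> S \<Longrightarrow> a + b \<in> S"
  shows "cring (monoid_algebra S :: ('a::comm_monoid_add \<Rightarrow>\<^sub>0 'k::comm_ring_1) ring)"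
proof (rule cringI)
  have keys_um: "Poly_Mapping.keys (- p) = Poly_Mapping.keys p" for p :: "'a \<Rightarrow>\<^sub>0 'k"
    by (auto simp: in_keys_iff)
  show "abelian_group (monoid_algebra S :: ('a \<Rightarrow>\<^sub>0 'k) ring)"
  proof (rule abelian_groupI)
    fix x :: "'a \<Rightarrow>\<^sub>0 'k" assume "x \<in> carrier (monoid_algebra S)"
    then show "\<exists>y\<in>carrier (monoid_algebra S). y \<oplus>\<^bsub>monoid_algebra S\<^esub> x = \<zero>\<^bsub>monoid_algebra S\<^esub>"
      by (intro bexI[of _ "- x"]) (auto simp: monoid_algebra_def keys_um)
  next
    fix x y :: "'a \<Rightarrow>\<^sub>0 'k"
    assume "x \<in> carrier (monoid_algebra S)" "y \<in> carrier (monoid_algebra S)"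
    then show "x \<oplus>\<^bsub>monoid_algebra S\<^esub> y \<in> carrier (monoid_algebra S)"
      using Poly_Mapping.keys_add[of x y] by (auto simp: monoid_algebra_def)
  qed (simp_all add: monoid_algebra_def add_ac)
  show "comm_monoid (monoid_algebra S :: ('a \<Rightarrow>\<^sub>0 'k) ring)"
  proof (rule comm_monoidI)
    fix x y :: "'a \<Rightarrow>\<^sub>0 'k"
    assume "x \<in> carrier (monoid_algebra S)" "y \<in> carrier (monoid_algebra S)"
    then show "x \<otimes>\<^bsub>monoid_algebra S\<^esub> y \<in> carrier (monoid_algebra S)"
      using keys_mult[of x y] assms(2) by (fastforce simp: monoid_algebra_def)
  qed (use assms in \<open>simp_all add: monoid_algebra_def mult_ac\<close>)
qed (simp add: monoid_algebra_def distrib_right)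

text \<open>The polynomial ring in the variables \<open>xvar i j\<close>, \<open>1 \<le> i \<le> n\<close>, \<open>1 \<le> j \<le> m\<close>.\<close>

definition poly_ring :: "nat \<Rightarrow> nat \<Rightarrow> ((nat \<times> nat \<Rightarrow>\<^sub>0 nat) \<Rightarrow>\<^sub>0 'k::comm_ring_1) ring" where
  "poly_ring n m = monoid_algebra {e. Poly_Mapping.keys e \<subseteq> {1..n} \<times> {1..m}}"

definition tableaux_algebra :: "nat \<Rightarrow> nat \<Rightarrow> (ssyt \<Rightarrow>\<^sub>0 'k::comm_ring_1) ring" where
  "tableaux_algebra n m = monoid_algebra (SSYT n m)"

abbreviation const :: "'k \<Rightarrow> ('a::zero \<Rightarrow>\<^sub>0 'k::zero)" where
  "const c \<equiv> Poly_Mapping.single 0 c"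

definition xvar :: "nat \<Rightarrow> nat \<Rightarrow> ((nat \<times> nat \<Rightarrow>\<^sub>0 nat) \<Rightarrow>\<^sub>0 'k::comm_ring_1)" where
  "xvar i j = Poly_Mapping.single (Poly_Mapping.single (i, j) 1) 1"

lemma cring_poly_ring: "cring (poly_ring n m)"
  unfolding poly_ring_def
proof (rule cring_monoid_algebra)
  fix a b :: "nat \<times> nat \<Rightarrow>\<^sub>0 nat"
  assume "a \<in> {e. Poly_Mapping.keys e \<subseteq> {1..n} \<times> {1..m}}" "b \<in> {e. Poly_Mapping.keys e \<subseteq> {1..n} \<times> {1..m}}"
  then show "a + b \<in> {e. Poly_Mapping.keys e \<subseteq> {1..n} \<times> {1..m}}"
    using Poly_Mapping.keys_add[of a b] by blast
qed simp

lemma cring_tableaux_algebra: "cring (tableaux_algebra n m)"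
  unfolding tableaux_algebra_def by (intro cring_monoid_algebra SSYT_zero SSYT_plus)


section \<open>The maximal spectrum\<close>

definition maxSpec :: "('a, 'b) ring_scheme \<Rightarrow> 'a set set" where
  "maxSpec R = {M. maximalideal M R}"

definition zero_locus :: "('a, 'b) ring_scheme \<Rightarrow> 'a set \<Rightarrow> 'a set set" where
  "zero_locus R I = {M \<in> maxSpec R. I \<subseteq> M}"

definition zariski :: "('a, 'b) ring_scheme \<Rightarrow> 'a set topology" where
  "zariski R = topology (\<lambda>U. \<exists>I. ideal I R \<and> U = maxSpec R - zero_locus R I)"

text \<open>For a commutative ring the declared sets do form a topology.\<close>

lemma istopology_zariski:
  assumes "cring R"
  shows "istopology (\<lambda>U. \<exists>I. ideal I R \<and> U = maxSpec R - zero_locus R I)"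
proof -
  interpret cring R by fact
  show ?thesis
    unfolding istopology_def
  proof (intro conjI allI impI)
    fix U V
    assume "\<exists>I. ideal I R \<and> U = maxSpec R - zero_locus R I"
      "\<exists>I. ideal I R \<and> V = maxSpec R - zero_locus R I"
    then obtain I J where I: "ideal I R" "U = maxSpec R - zero_locus R I"
      and J: "ideal J R" "V = maxSpec R - zero_locus R J" by auto
    have "U \<inter> V = maxSpec R - zero_locus R (I \<inter> J)"
    proof -
      have "I \<subseteq> M \<or> J \<subseteq> M" if M: "maximalideal M R" "I \<inter> J \<subseteq> M" for M
      proof (rule ccontr)
        assume "\<not> (I \<subseteq> M \<or> J \<subseteq> M)"
        then obtain a b where ab: "a \<in> I" "a \<notin> M" "b \<in> J" "b \<notin> M" by auto
        have c: "a \<in> carrier R" "b \<in> carrier R"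
          using ab I J by (auto intro: ideal.Icarr)
        have "a \<otimes>\<^bsub>R\<^esub> b \<in> I \<inter> J"
          using ideal.I_r_closed[OF I(1) ab(1) c(2)] ideal.I_l_closed[OF J(1) ab(3) c(1)] by blast
        then show False
          using M ab c primeideal.I_prime[OF maximalideal_prime[OF M(1)]] by blast
      qed
      then show ?thesis
        unfolding I J zero_locus_def maxSpec_def by auto
    qed
    then show "\<exists>I. ideal I R \<and> U \<inter> V = maxSpec R - zero_locus R I"
      using i_intersect[OF I(1) J(1)] by blast
  next
    fix K
    assume K: "\<forall>U\<in>K. \<exists>I. ideal I R \<and> U = maxSpec R - zero_locus R I"
    obtain f where fK: "\<forall>U\<in>K. ideal (f U) R \<and> U = maxSpec R - zero_locus R (f U)"
      using bchoice[OF K] by (rule exE)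
    have f: "ideal (f U) R" if "U \<in> K" for U
      using bspec[OF fK that] by (rule conjunct1)
    have feq: "maxSpec R - zero_locus R (f U) = U" if "U \<in> K" for U
      using bspec[OF fK that] by (rule conjunct2[THEN sym])
    have sub: "(\<Union>U\<in>K. f U) \<subseteq> carrier R"
      using f by (auto dest: ideal.Icarr)
    have "genideal R (\<Union>U\<in>K. f U) \<subseteq> M \<longleftrightarrow> (\<forall>U\<in>K. f U \<subseteq> M)" if "M \<in> maxSpec R" for M
      using genideal_minimal[of M "\<Union>U\<in>K. f U"] genideal_self[OF sub] that
        maximalideal.axioms(1)[of M R]
      by (auto simp: maxSpec_def)
    then have "(\<Union>U\<in>K. maxSpec R - zero_locus R (f U)) =
        maxSpec R - zero_locus R (genideal R (\<Union>U\<in>K. f U))"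
      by (auto simp: zero_locus_def)
    moreover have "\<Union>K = (\<Union>U\<in>K. maxSpec R - zero_locus R (f U))"
      using feq by simp
    ultimately have "\<Union>K = maxSpec R - zero_locus R (genideal R (\<Union>U\<in>K. f U))"
      by (rule trans[rotated])
    then show "\<exists>I. ideal I R \<and> \<Union>K = maxSpec R - zero_locus R I"
      using genideal_ideal[OF sub] by blast
  qed
qed

lemma openin_zariski:
  "cring R \<Longrightarrow> openin (zariski R) U \<longleftrightarrow> (\<exists>I. ideal I R \<and> U = maxSpec R - zero_locus R I)"
  unfolding zariski_def by (simp add: istopology_zariski)

lemma topspace_zariski:
  assumes "cring R"
  shows "topspace (zariski R) = maxSpec R"
proof -
  interpret cring R by fact
  have "zero_locus R (carrier R) = {}"
    by (auto simp: zero_locus_def maxSpec_def maximalideal_def maximalideal_axioms_def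
        dest: ideal.Icarr)
  then have "openin (zariski R) (maxSpec R)"
    using oneideal by (auto simp: openin_zariski[OF assms])
  moreover have "openin (zariski R) U \<Longrightarrow> U \<subseteq> maxSpec R" for U
    by (auto simp: openin_zariski[OF assms])
  ultimately show ?thesis
    unfolding topspace_def by blast
qed


section \<open>The map on maximal spectra\<close>

text \<open>Points of \<open>K^(nm)\<close> are functions of \<open>i\<close> and \<open>j\<close>, of which only the values for
  \<open>i \<in> {1..n}\<close>, \<open>j \<in> {1..m}\<close> are ever used; points of \<open>K^d\<close> are functions on the one-column
  tableaux.\<close>

definition N_ideal :: "nat \<Rightarrow> nat \<Rightarrow> (nat \<Rightarrow> nat \<Rightarrow> 'k) \<Rightarrow> ((nat \<times> nat \<Rightarrow>\<^sub>0 nat) \<Rightarrow>\<^sub>0 'k::comm_ring_1) set" where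
  "N_ideal n m \<alpha> = genideal (poly_ring n m) {xvar i j - const (\<alpha> i j) | i j. i \<in> {1..n} \<and> j \<in> {1..m}}"

definition M_ideal :: "nat \<Rightarrow> nat \<Rightarrow> (ssyt \<Rightarrow> 'k) \<Rightarrow> (ssyt \<Rightarrow>\<^sub>0 'k::comm_ring_1) set" where
  "M_ideal n m t = genideal (tableaux_algebra n m)
     {Poly_Mapping.single T 1 - const (t T) | T. T \<in> one_column n m}"

definition ev_tableau :: "nat \<Rightarrow> nat \<Rightarrow> (nat \<Rightarrow> nat \<Rightarrow> 'k::comm_ring_1) \<Rightarrow> ssyt \<Rightarrow> 'k" where
  "ev_tableau n m \<alpha> T = (\<Prod>i=1..n. \<Prod>j=1..m. \<alpha> i j ^ wt T i j)"

definition Psi :: "nat \<Rightarrow> nat \<Rightarrow> (nat \<Rightarrow> nat \<Rightarrow> 'k::comm_ring_1) \<Rightarrow> ssyt \<Rightarrow> 'k" where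
  "Psi n m \<alpha> = restrict (ev_tableau n m \<alpha>) (one_column n m)"

definition Psi_star ::
  "nat \<Rightarrow> nat \<Rightarrow> ((nat \<times> nat \<Rightarrow>\<^sub>0 nat) \<Rightarrow>\<^sub>0 'k::comm_ring_1) set \<Rightarrow> (ssyt \<Rightarrow>\<^sub>0 'k) set" where
  "Psi_star n m N = (THE M. \<exists>\<alpha>. N = N_ideal n m \<alpha> \<and> M = M_ideal n m (Psi n m \<alpha>))"

text \<open>\<open>Psi_star\<close> is well defined: evaluation at \<open>\<alpha>\<close> shows that \<open>N_ideal n m \<alpha>\<close>
  determines the coordinates of \<open>\<alpha>\<close>.\<close>

definition lin_ext :: "('a \<Rightarrow> 'k) \<Rightarrow> ('a \<Rightarrow>\<^sub>0 'k::comm_ring_1) \<Rightarrow> 'k" where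
  "lin_ext \<chi> p = (\<Sum>a\<in>Poly_Mapping.keys p. Poly_Mapping.lookup p a * \<chi> a)"

lemma lin_ext_superset:
  "finite A \<Longrightarrow> Poly_Mapping.keys p \<subseteq> A \<Longrightarrow> lin_ext \<chi> p = (\<Sum>a\<in>A. Poly_Mapping.lookup p a * \<chi> a)"
  unfolding lin_ext_def by (rule sum.mono_neutral_left) (auto simp: in_keys_iff)

lemma lin_ext_add: "lin_ext \<chi> (p + q) = lin_ext \<chi> p + lin_ext \<chi> q"
proof -
  let ?A = "Poly_Mapping.keys p \<union> Poly_Mapping.keys q"
  have "Poly_Mapping.keys (p + q) \<subseteq> ?A" by (rule Poly_Mapping.keys_add)
  then show ?thesis
    by (simp add: lin_ext_superset[of ?A] lookup_add distrib_right sum.distrib)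
qed

lemma lin_ext_single [simp]: "lin_ext \<chi> (Poly_Mapping.single a c) = c * \<chi> a"
  by (simp add: lin_ext_def)

lemma lin_ext_zero [simp]: "lin_ext \<chi> 0 = 0"
  by (simp add: lin_ext_def)

lemma lin_ext_diff: "lin_ext \<chi> (p - q) = lin_ext \<chi> p - lin_ext \<chi> q"
  using lin_ext_add[of \<chi> "p - q" q] by simp

lemma lin_ext_sum: "lin_ext \<chi> (sum f A) = (\<Sum>a\<in>A. lin_ext \<chi> (f a))"
  by (induction A rule: infinite_finite_induct) (auto simp: lin_ext_add)

lemma sum_single_keys:
  "p = (\<Sum>a\<in>Poly_Mapping.keys p. Poly_Mapping.single a (Poly_Mapping.lookup p a))"
  by (rule poly_mapping_eqI)
    (auto simp: lookup_sum lookup_single when_def in_keys_iff sum.delta)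

lemma lin_ext_mult:
  fixes \<chi> :: "'a::comm_monoid_add \<Rightarrow> 'k::comm_ring_1"
  assumes "\<And>a b. \<chi> (a + b) = \<chi> a * \<chi> b"
  shows "lin_ext \<chi> (p * q) = lin_ext \<chi> p * lin_ext \<chi> q"
proof -
  have "lin_ext \<chi> (p * q) =
    lin_ext \<chi> ((\<Sum>a\<in>Poly_Mapping.keys p. Poly_Mapping.single a (Poly_Mapping.lookup p a)) *
      (\<Sum>b\<in>Poly_Mapping.keys q. Poly_Mapping.single b (Poly_Mapping.lookup q b)))"
    by (metis sum_single_keys)
  also have "\<dots> = (\<Sum>a\<in>Poly_Mapping.keys p. \<Sum>b\<in>Poly_Mapping.keys q.
      (Poly_Mapping.lookup p a * \<chi> a) * (Poly_Mapping.lookup q b * \<chi> b))"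
    unfolding sum_product lin_ext_sum mult_single lin_ext_single assms by (simp add: mult_ac)
  also have "\<dots> = lin_ext \<chi> p * lin_ext \<chi> q"
    by (simp add: lin_ext_def sum_product)
  finally show ?thesis .
qed

lemma kernel_ideal:
  fixes \<chi> :: "'a::comm_monoid_add \<Rightarrow> 'k::comm_ring_1"
  assumes "cring (monoid_algebra S :: ('a \<Rightarrow>\<^sub>0 'k) ring)"
    and "\<And>a b. \<chi> (a + b) = \<chi> a * \<chi> b"
  shows "ideal {p \<in> carrier (monoid_algebra S). lin_ext \<chi> p = 0} (monoid_algebra S)"
proof -
  let ?R = "monoid_algebra S :: ('a \<Rightarrow>\<^sub>0 'k) ring"
  interpret R: cring ?R by fact
  have simps: "monoid.mult ?R = (*)" "add ?R = (+)" "zero ?R = 0"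
    by (simp_all add: monoid_algebra_def)
  have keys_um: "Poly_Mapping.keys (- p) = Poly_Mapping.keys p" for p :: "'a \<Rightarrow>\<^sub>0 'k"
    by (auto simp: in_keys_iff)
  have inv: "a_inv ?R x = - x" if "x \<in> carrier ?R" for x
    by (rule R.minus_equality) (use that in \<open>auto simp: simps monoid_algebra_def keys_um\<close>)
  have um: "lin_ext \<chi> (- x) = - lin_ext \<chi> x" for x
    using lin_ext_diff[of \<chi> 0 x] by simp
  have closed: "x * y \<in> carrier ?R" "x + y \<in> carrier ?R"
    if "x \<in> carrier ?R" "y \<in> carrier ?R" for x y
    using R.m_closed[OF that] R.a_closed[OF that] by (simp_all add: simps)
  have umc: "- x \<in> carrier ?R" if "x \<in> carrier ?R" for x
    using that by (simp add: monoid_algebra_def keys_um)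
  show ?thesis
  proof (rule idealI)
    show "ring ?R" by (rule R.ring_axioms)
    have "0 \<in> carrier ?R" using R.zero_closed by (simp add: simps)
    then show "subgroup {p \<in> carrier ?R. lin_ext \<chi> p = 0} (add_monoid ?R)"
      by (intro R.add.subgroupI)
        (auto simp: simps closed lin_ext_add um umc inv simp flip: a_inv_def)
  qed (auto simp: simps closed lin_ext_mult[OF assms(2)])
qed

lemma N_ideal_inj:
  fixes \<alpha> \<beta> :: "nat \<Rightarrow> nat \<Rightarrow> 'k::comm_ring_1"
  assumes "N_ideal n m \<alpha> = N_ideal n m \<beta>" and ij: "i \<in> {1..n}" "j \<in> {1..m}"
  shows "\<alpha> i j = \<beta> i j"
proof -
  define S where "S = {e :: nat \<times> nat \<Rightarrow>\<^sub>0 nat. Poly_Mapping.keys e \<subseteq> {1..n} \<times> {1..m}}"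
  define R where "R = (monoid_algebra S :: (_ \<Rightarrow>\<^sub>0 'k) ring)"
  define \<chi> where "\<chi> e = (\<Prod>i=1..n. \<Prod>j=1..m. \<alpha> i j ^ Poly_Mapping.lookup e (i, j))" for e
  let ?gen = "\<lambda>\<gamma>. {xvar i j - const (\<gamma> i j) | i j. i \<in> {1..n} \<and> j \<in> {1..m}} :: (_ \<Rightarrow>\<^sub>0 'k) set"
  have R: "poly_ring n m = R" by (simp add: poly_ring_def R_def S_def)
  interpret R: cring R using cring_poly_ring R by metis
  have \<chi>: "\<chi> (a + b) = \<chi> a * \<chi> b" for a b
    by (simp add: \<chi>_def lookup_add power_add prod.distrib)
  have gen: "?gen \<gamma> \<subseteq> carrier R" for \<gamma>
  proof safe
    fix i j assume ij: "i \<in> {1..n}" "j \<in> {1..m}"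
    have "Poly_Mapping.keys (xvar i j - const (\<gamma> i j)) \<subseteq>
        Poly_Mapping.keys (xvar i j :: _ \<Rightarrow>\<^sub>0 'k) \<union>
        Poly_Mapping.keys (const (\<gamma> i j) :: (nat \<times> nat \<Rightarrow>\<^sub>0 nat) \<Rightarrow>\<^sub>0 'k)"
      by (auto simp: in_keys_iff lookup_minus simp del: keys_single)
    also have "\<dots> \<subseteq> S"
      using ij by (auto simp: S_def xvar_def)
    finally show "xvar i j - const (\<gamma> i j) \<in> carrier R"
      by (simp add: R_def monoid_algebra_def)
  qed
  have \<chi>0: "\<chi> 0 = 1" by (simp add: \<chi>_def)
  have \<chi>1: "\<chi> (Poly_Mapping.single (i, j) 1) = \<alpha> i j" if "i \<in> {1..n}" "j \<in> {1..m}" for i j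
  proof -
    have "\<chi> (Poly_Mapping.single (i, j) 1) =
       (\<Prod>k=1..n. \<Prod>l=1..m. if l = j then (if k = i then \<alpha> i j else 1) else 1)"
      unfolding \<chi>_def by (intro prod.cong refl) (auto simp: lookup_single when_def)
    then show ?thesis using that by (simp add: prod.delta)
  qed
  have ev: "lin_ext \<chi> (xvar i j - const c) = \<alpha> i j - c" if "i \<in> {1..n}" "j \<in> {1..m}" for i j c
    using \<chi>1[OF that] by (simp add: lin_ext_diff xvar_def \<chi>0)
  have "N_ideal n m \<alpha> \<subseteq> {p \<in> carrier R. lin_ext \<chi> p = 0}"
    unfolding N_ideal_def R
  proof (rule R.genideal_minimal)
    show "ideal {p \<in> carrier R. lin_ext \<chi> p = 0} R"
      using kernel_ideal[of S \<chi>] \<chi> R.is_cring unfolding R_def by blast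
    show "?gen \<alpha> \<subseteq> {p \<in> carrier R. lin_ext \<chi> p = 0}"
      using gen[of \<alpha>] ev by auto
  qed
  moreover have "xvar i j - const (\<beta> i j) \<in> N_ideal n m \<beta>"
    unfolding N_ideal_def R using R.genideal_self[OF gen[of \<beta>]] ij by blast
  ultimately have "lin_ext \<chi> (xvar i j - const (\<beta> i j)) = 0"
    using assms(1) by blast
  then show ?thesis using ev[OF ij] by simp
qed

lemma Psi_star_N_ideal: "Psi_star n m (N_ideal n m \<alpha>) = M_ideal n m (Psi n m \<alpha>)"
proof -
  have "Psi n m \<alpha> = Psi n m \<beta>" if "N_ideal n m \<alpha> = N_ideal n m \<beta>" for \<beta>
    unfolding Psi_def ev_tableau_def
    using N_ideal_inj[OF that] by (intro restrict_ext prod.cong refl) auto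
  then show ?thesis
    unfolding Psi_star_def by (intro the_equality) metis+
qed

end

theory Submission
  imports Defs
begin

text \<open>A tableau \<open>T\<close> has a monomial, the product of the variables \<open>x i j\<close> to the powers \<open>wt T i j\<close>, and
since the weights are additive under \<open>\<star>\<close> this defines an algebra homomorphism \<open>\<phi>\<close>
(\<open>tableau_poly\<close>) from the tableaux algebra to the polynomial ring. Evaluating \<open>\<phi> p\<close> at \<open>\<alpha>\<close> is the
same as evaluating \<open>p\<close> by means of \<open>ev_tableau\<close> (\<open>tableau_poly_value\<close>). Now \<open>N_ideal\<close> is the
kernel of the former evaluation (\<open>N_ideal_eq_kernel\<close>), and \<open>M_ideal\<close> at \<open>\<Psi>(\<alpha>)\<close> is the kernel of
the latter (\<open>M_ideal_Psi\<close>), because the one-column tableaux generate the monoid. So \<open>\<Psi>\<^sup>*\<close> is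
contraction of ideals along \<open>\<phi>\<close>, and the inverse image of the closed set of an ideal \<open>I\<close> is the
closed set of the ideal generated by \<open>\<phi>(I)\<close>.

This describes the map on all of the spectrum only if every maximal ideal of the polynomial ring has
the form \<open>N_ideal n m \<alpha>\<close>, which is Hilbert's Nullstellensatz in its weak form
(\<open>weak_nullstellensatz\<close>). The proof given here goes through Goldman domains, the domains whose field
of fractions arises by inverting a single element. If \<open>A[x]\<close> is a Goldman domain, then \<open>x\<close> is
algebraic over \<open>A\<close> (\<open>goldman_adjoin_imp_algebraic\<close>) and \<open>A\<close> is a Goldman domain
(\<open>goldman_adjoin_imp_goldman\<close>). The quotient of the polynomial ring by a maximal ideal is a field,
in particular a Goldman domain. Dropping all generators but one shows that each variable is
algebraic over the algebraically closed field \<open>K\<close> modulo the maximal ideal, and therefore congruent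
to a constant.\<close>

section \<open>Subrings generated by one element\<close>

definition unital_subring :: "'a::comm_ring_1 set \<Rightarrow> bool" where
  "unital_subring A \<longleftrightarrow> 1 \<in> A \<and> (\<forall>a\<in>A. \<forall>b\<in>A. a - b \<in> A \<and> a * b \<in> A)"

lemma unital_subringD:
  assumes "unital_subring A"
  shows "0 \<in> A" "1 \<in> A" "a \<in> A \<Longrightarrow> - a \<in> A"
    "a \<in> A \<Longrightarrow> b \<in> A \<Longrightarrow> a + b \<in> A" "a \<in> A \<Longrightarrow> b \<in> A \<Longrightarrow> a - b \<in> A"
    "a \<in> A \<Longrightarrow> b \<in> A \<Longrightarrow> a * b \<in> A" "a \<in> A \<Longrightarrow> a ^ k \<in> A"
    "(\<And>i. i \<in> X \<Longrightarrow> f i \<in> A) \<Longrightarrow> sum f X \<in> A"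
proof -
  have A: "1 \<in> A" "\<And>a b. a \<in> A \<Longrightarrow> b \<in> A \<Longrightarrow> a - b \<in> A" "\<And>a b. a \<in> A \<Longrightarrow> b \<in> A \<Longrightarrow> a * b \<in> A"
    using assms by (auto simp: unital_subring_def)
  show z: "0 \<in> A" using A(2)[OF A(1) A(1)] by simp
  have um: "- a \<in> A" if "a \<in> A" for a using A(2)[OF z that] by simp
  have add: "a + b \<in> A" if "a \<in> A" "b \<in> A" for a b using A(2)[OF that(1) um[OF that(2)]] by simp
  show "1 \<in> A" "a \<in> A \<Longrightarrow> - a \<in> A"
    "a \<in> A \<Longrightarrow> b \<in> A \<Longrightarrow> a + b \<in> A" "a \<in> A \<Longrightarrow> b \<in> A \<Longrightarrow> a - b \<in> A"
    "a \<in> A \<Longrightarrow> b \<in> A \<Longrightarrow> a * b \<in> A"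
    using A um add by auto
  show "a ^ k \<in> A" if "a \<in> A"
    by (induction k) (auto simp: A that)
  show "sum f X \<in> A" if "\<And>i. i \<in> X \<Longrightarrow> f i \<in> A"
    using that by (induction X rule: infinite_finite_induct) (auto simp: z add)
qed

definition coeffs_in :: "'a::comm_ring_1 set \<Rightarrow> 'a poly \<Rightarrow> bool" where
  "coeffs_in A p \<longleftrightarrow> (\<forall>i. coeff p i \<in> A)"

lemma coeffs_in_closed:
  assumes "unital_subring A"
  shows "coeffs_in A 0" "coeffs_in A 1"
    "coeffs_in A p \<Longrightarrow> coeffs_in A q \<Longrightarrow> coeffs_in A (p + q)"
    "coeffs_in A p \<Longrightarrow> coeffs_in A q \<Longrightarrow> coeffs_in A (p - q)"
    "coeffs_in A p \<Longrightarrow> coeffs_in A q \<Longrightarrow> coeffs_in A (p * q)"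
    "a \<in> A \<Longrightarrow> coeffs_in A p \<Longrightarrow> coeffs_in A (smult a p)"
    "a \<in> A \<Longrightarrow> coeffs_in A p \<Longrightarrow> coeffs_in A (pCons a p)"
    "a \<in> A \<Longrightarrow> coeffs_in A (monom a k)"
  using unital_subringD[OF assms]
  by (auto simp: coeffs_in_def coeff_mult coeff_1 coeff_pCons split: nat.split
      intro!: unital_subringD(8)[OF assms])

lemma coeffs_in_mono: "coeffs_in A p \<Longrightarrow> A \<subseteq> B \<Longrightarrow> coeffs_in B p"
  by (auto simp: coeffs_in_def)

definition adjoin :: "'a::comm_ring_1 set \<Rightarrow> 'a \<Rightarrow> 'a set" where
  "adjoin A x = {poly p x | p. coeffs_in A p}"

lemma unital_subring_adjoin:
  assumes A: "unital_subring A"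
  shows "unital_subring (adjoin A x)"
  unfolding unital_subring_def adjoin_def
proof safe
  show "\<exists>p. 1 = poly p x \<and> coeffs_in A p"
    using A by (intro exI[of _ 1]) (simp add: coeffs_in_closed)
  fix p q assume pq: "coeffs_in A p" "coeffs_in A q"
  show "\<exists>r. poly p x - poly q x = poly r x \<and> coeffs_in A r"
    using A pq by (intro exI[of _ "p - q"]) (simp add: coeffs_in_closed)
  show "\<exists>r. poly p x * poly q x = poly r x \<and> coeffs_in A r"
    using A pq by (intro exI[of _ "p * q"]) (simp add: coeffs_in_closed)
qed

lemma poly_mem:
  assumes "unital_subring A" "coeffs_in A p" "x \<in> A"
  shows "poly p x \<in> A"
  unfolding poly_altdef using assms unital_subringD[OF assms(1)]
  by (intro unital_subringD(8)[OF assms(1)]) (auto simp: coeffs_in_def)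

lemma adjoin_subset: "unital_subring S \<Longrightarrow> A \<subseteq> S \<Longrightarrow> x \<in> S \<Longrightarrow> adjoin A x \<subseteq> S"
  by (auto simp: adjoin_def intro: poly_mem coeffs_in_mono)

lemma subset_adjoin: "unital_subring A \<Longrightarrow> A \<subseteq> adjoin A x"
proof
  fix a assume "unital_subring A" "a \<in> A"
  then show "a \<in> adjoin A x"
    unfolding adjoin_def by (intro CollectI exI[of _ "[:a:]"]) (auto intro!: coeffs_in_closed)
qed

lemma generator_in_adjoin: "unital_subring A \<Longrightarrow> x \<in> adjoin A x"
  unfolding adjoin_def by (intro CollectI exI[of _ "[:0,1:]"])
    (auto intro!: coeffs_in_closed simp: unital_subringD)

text \<open>Long division without inverting the leading coefficient of the divisor. Over a general commutative
ring the degree of the quotient cannot be recovered from that of its product with the divisor, so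
its bound is part of the conclusion.\<close>

lemma pseudo_division:
  fixes p g :: "'a::comm_ring_1 poly"
  assumes A: "unital_subring A" and g: "coeffs_in A g" "degree g > 0" and p: "coeffs_in A p"
  shows "\<exists>k q r. coeffs_in A q \<and> coeffs_in A r \<and> smult (lead_coeff g ^ k) p = q * g + r \<and>
    degree r < degree g \<and> degree q \<le> degree p - degree g"
  using p
proof (induction "degree p" arbitrary: p rule: less_induct)
  case (less p)
  note cl = coeffs_in_closed[OF A] unital_subringD[OF A]
  show ?case
  proof (cases "degree p < degree g")
    case True
    then show ?thesis
      using less.prems by (intro exI[of _ 0] exI[of _ 0] exI[of _ p]) (auto simp: cl)
  next
    case False
    define c where "c = lead_coeff g"
    define t where "t = monom (lead_coeff p) (degree p - degree g)"
    define p' where "p' = smult c p - t * g"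
    have cA: "c \<in> A" using g by (simp add: c_def coeffs_in_def)
    have t: "coeffs_in A t" unfolding t_def using less.prems by (auto intro!: cl simp: coeffs_in_def)
    have p'A: "coeffs_in A p'" unfolding p'_def by (intro cl cA less.prems t g)
    have "degree t \<le> degree p - degree g" by (simp add: t_def degree_monom_le)
    then have "degree p' \<le> degree p"
      unfolding p'_def using False
      by (intro degree_diff_le order_trans[OF degree_smult_le] order_trans[OF degree_mult_le]) auto
    moreover have "coeff p' (degree p) = 0"
      using False unfolding p'_def t_def c_def coeff_diff coeff_smult coeff_monom_mult
      by (simp add: mult.commute)
    ultimately have lt: "degree p' < degree p"
      using False g(2) by (metis degree_0 eq_zero_or_degree_less gr_zeroI le_neq_implies_less leading_coeff_0_iff not_less)
    from less.hyps[OF lt p'A] obtain k q r where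
      *: "coeffs_in A q" "coeffs_in A r" "smult (c ^ k) p' = q * g + r"
         "degree r < degree g" "degree q \<le> degree p' - degree g"
      unfolding c_def by blast
    have "smult (c ^ Suc k) p = smult (c ^ k) (p' + t * g)" by (simp add: p'_def mult.commute)
    also have "\<dots> = (q + smult (c ^ k) t) * g + r"
      using *(3) by (simp add: smult_add_right algebra_simps)
    finally have "smult (c ^ Suc k) p = (q + smult (c ^ k) t) * g + r" .
    moreover have "coeffs_in A (q + smult (c ^ k) t)" by (intro cl * cA t)
    moreover have "degree (q + smult (c ^ k) t) \<le> degree p - degree g"
      using *(5) lt \<open>degree t \<le> _\<close>
      by (intro degree_add_le order_trans[OF degree_smult_le]) auto
    ultimately show ?thesis
      using * unfolding c_def by blast
  qed
qed

section \<open>Goldman domains\<close>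

text \<open>Quotients are avoided: the domain \<open>S/M\<close> is handled through representatives in \<open>S\<close>, with
\<open>a = b\<close> in the quotient expressed as \<open>a - b \<in> M\<close>. A subring \<open>A\<close> of \<open>S\<close> stands for its
image in \<open>S/M\<close>; it need not contain \<open>M\<close>. Keeping all the rings inside one type makes it
possible to descend through a chain of subrings.\<close>

locale prime_in_subring =
  fixes S M :: "'a::comm_ring_1 set"
  assumes S: "unital_subring S"
    and M_sub: "M \<subseteq> S"
    and M_zero: "0 \<in> M"
    and M_add: "a \<in> M \<Longrightarrow> b \<in> M \<Longrightarrow> a + b \<in> M"
    and M_mult: "a \<in> S \<Longrightarrow> b \<in> M \<Longrightarrow> a * b \<in> M"
    and one_notin_M: "1 \<notin> M"
    and M_prime: "a \<in> S \<Longrightarrow> b \<in> S \<Longrightarrow> a * b \<in> M \<Longrightarrow> a \<in> M \<or> b \<in> M"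
begin

lemma M_uminus: "a \<in> M \<Longrightarrow> - a \<in> M"
  using M_mult[of "- 1" a] unital_subringD[OF S] by simp

lemma M_diff: "a \<in> M \<Longrightarrow> b \<in> M \<Longrightarrow> a - b \<in> M"
  using M_add[of a "- b"] M_uminus by simp

lemma M_sum: "(\<And>i. i \<in> X \<Longrightarrow> f i \<in> M) \<Longrightarrow> sum f X \<in> M"
  by (induction X rule: infinite_finite_induct) (auto simp: M_zero M_add)

lemma power_notin_M: "a \<in> S \<Longrightarrow> a \<notin> M \<Longrightarrow> a ^ k \<notin> M"
  using M_prime unital_subringD(7)[OF S] by (induction k) (auto simp: one_notin_M)

lemma M_cong: "a - b \<in> M \<Longrightarrow> a \<in> M \<longleftrightarrow> b \<in> M"
  using M_add[of "a - b" b] M_diff[of a "a - b"] by auto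

lemma cong_mult:
  assumes "a - b \<in> M" "c - d \<in> M" "b \<in> S" "c \<in> S"
  shows "a * c - b * d \<in> M"
proof -
  have "a * c - b * d = c * (a - b) + b * (c - d)" by (simp add: algebra_simps)
  then show ?thesis using assms by (auto intro!: M_add M_mult)
qed

lemma cong_power:
  assumes "a - b \<in> M" "a \<in> S" "b \<in> S"
  shows "a ^ k - b ^ k \<in> M"
proof (induction k)
  case (Suc k)
  then show ?case using assms unital_subringD(7)[OF S] by (auto intro!: cong_mult)
qed (simp add: M_zero)

lemma cong_trans: "a - b \<in> M \<Longrightarrow> b - c \<in> M \<Longrightarrow> a - c \<in> M"
  using M_add[of "a - b" "b - c"] by simp

lemma poly_M:
  assumes "coeffs_in M p" "x \<in> S"
  shows "poly p x \<in> M"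
  using assms M_mult[of "x ^ _"] unital_subringD(7)[OF S]
  by (auto simp: poly_altdef coeffs_in_def mult.commute[of "coeff _ _"] intro!: M_sum)

lemma coeffs_in_M_mult:
  assumes "coeffs_in S p" "coeffs_in M q"
  shows "coeffs_in M (p * q)"
  using assms by (auto simp: coeffs_in_def coeff_mult intro!: M_sum M_mult)

text \<open>Modulo \<open>M\<close> the degree of a polynomial is the largest index of a coefficient outside \<open>M\<close>.
Discarding the terms above it gives a congruent polynomial for which this is also the degree in the
ordinary sense, so that degrees and leading coefficients behave as over the domain \<open>S/M\<close>.\<close>

lemma drop_M_terms:
  assumes A: "unital_subring A" and p: "coeffs_in A p" "\<not> coeffs_in M p"
  obtains q where "coeffs_in A q" "lead_coeff q \<notin> M" "coeffs_in M (p - q)" "degree q \<le> degree p"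
proof -
  define d where "d = Max {i. coeff p i \<notin> M}"
  have fin: "finite {i. coeff p i \<notin> M}"
    by (rule finite_subset[of _ "{..degree p}"]) (auto simp: M_zero intro!: le_degree)
  have ne: "{i. coeff p i \<notin> M} \<noteq> {}" using p by (auto simp: coeffs_in_def)
  have d: "coeff p d \<notin> M" using Max_in[OF fin ne] by (simp add: d_def)
  have gt: "coeff p i \<in> M" if "i > d" for i
    using Max_ge[OF fin, of i] that by (auto simp: d_def)
  define q where "q = (\<Sum>i\<le>d. monom (coeff p i) i)"
  have co: "coeff q i = (if i \<le> d then coeff p i else 0)" for i
    by (simp add: q_def coeff_sum sum.delta)
  have dq: "degree q = d"
    using d M_zero co by (intro antisym degree_le le_degree) auto
  show ?thesis
  proof
    show "coeffs_in A q" using p unital_subringD[OF A] by (auto simp: coeffs_in_def co)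
    show "lead_coeff q \<notin> M" using d by (simp add: dq co)
    show "coeffs_in M (p - q)" using gt M_zero by (auto simp: coeffs_in_def co not_le)
    show "degree q \<le> degree p" using d M_zero by (auto simp: dq intro: le_degree)
  qed
qed

text \<open>The image of \<open>A\<close> in \<open>S/M\<close> is a Goldman domain: inverting the single nonzero element \<open>f\<close>
inverts every nonzero element. A field is one, with \<open>f = 1\<close>.\<close>

definition goldman :: "'a set \<Rightarrow> bool" where
  "goldman A \<longleftrightarrow> (\<exists>f\<in>A - M. \<forall>c\<in>A - M. \<exists>N. \<exists>h\<in>A. f ^ N - c * h \<in> M)"

text \<open>A polynomial ring over a domain is not a Goldman domain. If \<open>x\<close> were transcendental, then
\<open>g = 1 + x f\<close> would divide a power of \<open>f\<close>; since it is coprime to \<open>f\<close>, it would be a unit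
of \<open>A[x]\<close>, although its degree in \<open>x\<close> is positive.\<close>

lemma goldman_adjoin_imp_algebraic:
  assumes A: "unital_subring A" "A \<subseteq> S" and x: "x \<in> S" and G: "goldman (adjoin A x)"
  shows "\<exists>p. coeffs_in A p \<and> \<not> coeffs_in M p \<and> poly p x \<in> M"
proof (rule ccontr)
  assume "\<not> ?thesis"
  then have tr: "coeffs_in M p" if "coeffs_in A p" "poly p x \<in> M" for p
    using that by blast
  let ?B = "adjoin A x"
  have B: "unital_subring ?B" using A by (intro unital_subring_adjoin)
  have BS: "?B \<subseteq> S"
    using S A x by (intro adjoin_subset)
  note cl = coeffs_in_closed[OF A(1)] unital_subringD[OF A(1)]
  note clB = unital_subringD[OF B] and clS = unital_subringD[OF S]
  obtain f where f: "f \<in> ?B" "f \<notin> M" "\<And>c. c \<in> ?B \<Longrightarrow> c \<notin> M \<Longrightarrow> \<exists>N. \<exists>h\<in>?B. f ^ N - c * h \<in> M"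
    using G by (auto simp: goldman_def)
  obtain F0 where F0: "coeffs_in A F0" "f = poly F0 x" using f by (auto simp: adjoin_def)
  have "\<not> coeffs_in M F0" using f(2) F0 poly_M x by blast
  with drop_M_terms[OF A(1) F0(1)] obtain F where
    F: "coeffs_in A F" "lead_coeff F \<notin> M" "coeffs_in M (F0 - F)" by blast
  have fF: "f - poly F x \<in> M" using poly_M[OF F(3) x] by (simp add: F0)
  define g where "g = poly (pCons 1 F) x"
  have gB: "g \<in> ?B" unfolding g_def adjoin_def using F by (auto intro!: cl exI[of _ "pCons 1 F"])
  have g_eq: "1 - g = - (x * poly F x)" by (simp add: g_def)
  have "g \<notin> M"
  proof
    assume "g \<in> M"
    then have "coeffs_in M (pCons 1 F)" unfolding g_def by (intro tr cl F)
    then have "coeff (pCons 1 F) 0 \<in> M" unfolding coeffs_in_def by blast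
    then show False using one_notin_M by simp
  qed
  from f(3)[OF gB this] obtain N h where h: "h \<in> ?B" "f ^ N - g * h \<in> M" by blast
  have FB: "poly F x \<in> ?B" using F by (auto simp: adjoin_def)
  have xB: "x \<in> ?B" by (rule generator_in_adjoin[OF A(1)])
  have "poly F x ^ N - f ^ N \<in> M"
    using M_uminus[OF fF] f FB BS by (intro cong_power) auto
  from cong_trans[OF this h(2)] have FN: "poly F x ^ N - g * h \<in> M" .
  \<comment> \<open>\<open>1 - (1 - g) ^ N\<close> is a multiple of \<open>g\<close>, and \<open>(1 - g) ^ N = (- x f) ^ N\<close> is one modulo \<open>M\<close>;
    \<open>h'\<close> is the resulting inverse of \<open>g\<close>.\<close>
  define h' where "h' = (\<Sum>i<N. (1 - g) ^ i) + (- x) ^ N * h"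
  have "1 - g * h' = (1 - g) ^ N - (- x) ^ N * (g * h)"
  proof -
    have "1 - (1 - g) ^ N = g * (\<Sum>i<N. (1 - g) ^ i)"
      using one_diff_power_eq[of "1 - g" N] by simp
    then show ?thesis by (simp add: h'_def algebra_simps)
  qed
  also have "\<dots> = (- x) ^ N * (poly F x ^ N - g * h)"
    unfolding g_eq by (simp add: right_diff_distrib flip: power_mult_distrib)
  also have "\<dots> \<in> M" using FN x clS by (intro M_mult) auto
  finally have gh: "1 - g * h' \<in> M" .
  have "h' \<in> ?B" unfolding h'_def by (intro clB gB h xB)
  then obtain H0 where H0: "coeffs_in A H0" "h' = poly H0 x" by (auto simp: adjoin_def)
  have "\<not> coeffs_in M H0"
  proof
    assume "coeffs_in M H0"
    then have "h' \<in> M" using H0 poly_M x by blast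
    then have "g * h' \<in> M" using gB BS M_mult by blast
    with gh M_cong one_notin_M show False by blast
  qed
  with drop_M_terms[OF A(1) H0(1)] obtain H where
    H: "coeffs_in A H" "lead_coeff H \<notin> M" "coeffs_in M (H0 - H)" by blast
  have "g * h' - g * poly H x \<in> M"
    using poly_M[OF H(3) x] M_mult[of g "h' - poly H x"] gB BS by (auto simp: H0 right_diff_distrib)
  from cong_trans[OF gh this] have "poly (1 - pCons 1 F * H) x \<in> M"
    by (simp add: g_def algebra_simps)
  then have *: "coeffs_in M (1 - pCons 1 F * H)" by (intro tr cl F H)
  \<comment> \<open>The leading coefficient of the product is not in \<open>M\<close>, and it sits in positive degree.\<close>
  have Fne: "F \<noteq> 0" using F(2) M_zero by auto
  let ?k = "degree (pCons 1 F) + degree H"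
  have "coeff (1 - pCons 1 F * H) ?k = - (lead_coeff F * lead_coeff H)"
    unfolding coeff_diff coeff_mult_degree_sum using Fne by (simp add: coeff_1)
  then have "- (lead_coeff F * lead_coeff H) \<in> M" using * by (metis coeffs_in_def)
  then have "lead_coeff F * lead_coeff H \<in> M" by (metis M_uminus minus_minus)
  moreover have "lead_coeff F \<in> S" "lead_coeff H \<in> S" using F H A by (auto simp: coeffs_in_def)
  ultimately show False using F H M_prime by blast
qed

lemma minimal_relation:
  assumes A: "unital_subring A" "A \<subseteq> S" and x: "x \<in> S"
    and ex: "\<exists>p. coeffs_in A p \<and> \<not> coeffs_in M p \<and> poly p x \<in> M"
  obtains b where "coeffs_in A b" "lead_coeff b \<notin> M" "poly b x \<in> M" "degree b > 0"
    "\<And>p. coeffs_in A p \<Longrightarrow> poly p x \<in> M \<Longrightarrow> degree p < degree b \<Longrightarrow> coeffs_in M p"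
proof -
  define Q where "Q p \<longleftrightarrow> coeffs_in A p \<and> \<not> coeffs_in M p \<and> poly p x \<in> M" for p
  obtain p where p: "Q p" "\<And>q. Q q \<Longrightarrow> degree p \<le> degree q"
    using ex_has_least_nat[of Q _ degree] ex unfolding Q_def by metis
  obtain b where b: "coeffs_in A b" "lead_coeff b \<notin> M" "coeffs_in M (p - b)" "degree b \<le> degree p"
    using drop_M_terms[OF A(1)] p(1) unfolding Q_def by metis
  have bx: "poly b x \<in> M"
    using M_cong[of "poly p x" "poly b x"] poly_M[OF b(3) x] p(1) by (simp add: Q_def)
  have "degree b \<noteq> 0"
  proof
    assume "degree b = 0"
    then obtain c where "b = [:c:]" by (rule degree_eq_zeroE)
    with b bx show False by simp
  qed
  moreover have "coeffs_in M q" if "coeffs_in A q" "poly q x \<in> M" "degree q < degree b" for q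
    using p(2)[of q] that b(4) unfolding Q_def by force
  ultimately show ?thesis using that b bx by blast
qed

text \<open>In an algebraic extension \<open>A[x]\<close> of domains every nonzero ideal meets \<open>A\<close> in a nonzero element.
Among the nonzero multiples of \<open>f\<close>, one \<open>r(x)\<close> of least degree in \<open>x\<close> is taken. Its degree is
below that of the minimal relation \<open>b\<close>, by reduction modulo \<open>b\<close>. If it were positive, dividing
\<open>b\<close> by \<open>r\<close> would leave a remainder whose value is a smaller multiple of \<open>f\<close>, hence zero, and
then \<open>b\<close> would factor modulo \<open>M\<close>; as \<open>r(x) \<noteq> 0\<close>, the cofactor would be a relation for \<open>x\<close> of
smaller degree than \<open>b\<close>.\<close>

lemma multiple_in_base:
  assumes A: "unital_subring A" "A \<subseteq> S" and x: "x \<in> S"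
    and b: "coeffs_in A b" "lead_coeff b \<notin> M" "poly b x \<in> M" "degree b > 0"
    and b_min: "\<And>p. coeffs_in A p \<Longrightarrow> poly p x \<in> M \<Longrightarrow> degree p < degree b \<Longrightarrow> coeffs_in M p"
    and f: "f \<in> adjoin A x" "f \<notin> M"
  shows "\<exists>e\<in>A - M. \<exists>u\<in>adjoin A x. e - u * f \<in> M"
proof -
  let ?B = "adjoin A x"
  have B: "unital_subring ?B" using A by (intro unital_subring_adjoin)
  have BS: "?B \<subseteq> S"
    using S A x by (intro adjoin_subset)
  have cS: "coeffs_in S p" if "coeffs_in A p" for p using that A by (auto simp: coeffs_in_def)
  note cl = coeffs_in_closed[OF A(1)] unital_subringD[OF A(1)]
  note clB = unital_subringD[OF B] and clS = unital_subringD[OF S]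
  have pB: "poly p x \<in> ?B" if "coeffs_in A p" for p using that by (auto simp: adjoin_def)
  define Q where "Q p \<longleftrightarrow> coeffs_in A p \<and> poly p x \<notin> M \<and> (\<exists>u\<in>?B. poly p x - u * f \<in> M)" for p
  obtain F where "coeffs_in A F" "f = poly F x" using f(1) by (auto simp: adjoin_def)
  then have "Q F"
    unfolding Q_def using f(2) clB(2) M_zero by (auto intro!: bexI[of _ 1])
  then obtain r0 where r0: "Q r0" "\<And>q. Q q \<Longrightarrow> degree r0 \<le> degree q"
    using ex_has_least_nat[of Q _ degree] by metis
  then have "\<not> coeffs_in M r0" using poly_M x unfolding Q_def by blast
  then obtain r where r: "coeffs_in A r" "lead_coeff r \<notin> M" "coeffs_in M (r0 - r)"
      "degree r \<le> degree r0"
    using drop_M_terms[OF A(1)] r0(1) unfolding Q_def by metis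
  have d: "poly r0 x - poly r x \<in> M" using poly_M[OF r(3) x] by simp
  then have rx: "poly r x \<notin> M" using M_cong r0(1) unfolding Q_def by blast
  obtain u where u: "u \<in> ?B" "poly r0 x - u * f \<in> M"
    using r0(1) unfolding Q_def by blast
  have "poly r x - poly r0 x \<in> M" using M_uminus[OF d] by simp
  from cong_trans[OF this u(2)] have ru: "poly r x - u * f \<in> M" .
  have r_min: "degree r \<le> degree q" if "Q q" for q using r0(2)[OF that] r(4) by simp
  have multiple: "Q q" if q: "coeffs_in A q" "poly q x \<notin> M" "v \<in> ?B" "poly q x - v * poly r x \<in> M" for q v
  proof -
    have "v * poly r x - v * u * f = v * (poly r x - u * f)" by (simp add: algebra_simps)
    then have "v * poly r x - v * u * f \<in> M" using M_mult[OF _ ru] BS q(3) by auto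
    from cong_trans[OF q(4) this] show ?thesis
      unfolding Q_def using q(1,2) clB(6)[OF q(3) u(1)] by blast
  qed
  have S': "lead_coeff r \<in> S" "lead_coeff b \<in> S" using r b A by (auto simp: coeffs_in_def)
  have lt: "degree r < degree b"
  proof -
    obtain k q s where s: "coeffs_in A q" "coeffs_in A s" "smult (lead_coeff b ^ k) r = q * b + s"
      "degree s < degree b"
      using pseudo_division[OF A(1) b(1,4) r(1)] by blast
    have "poly s x = lead_coeff b ^ k * poly r x - poly q x * poly b x"
      using arg_cong[OF s(3), of "\<lambda>p. poly p x"] by simp
    then have "poly s x - lead_coeff b ^ k * poly r x = - (poly q x * poly b x)" by simp
    also have "\<dots> \<in> M" using pB[OF s(1)] BS b(3) by (intro M_uminus M_mult) auto
    finally have sx: "poly s x - lead_coeff b ^ k * poly r x \<in> M" .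
    have "lead_coeff b ^ k * poly r x \<notin> M"
      using M_prime[of "lead_coeff b ^ k" "poly r x"] power_notin_M[OF S'(2) b(2), of k] rx
        pB[OF r(1)] BS clS(7)[OF S'(2), of k] by auto
    then have "poly s x \<notin> M" using M_cong[OF sx] by blast
    moreover have "lead_coeff b ^ k \<in> ?B"
      using b(1) subset_adjoin[OF A(1)] by (intro clB) (auto simp: coeffs_in_def)
    ultimately have "Q s" using multiple s(2) sx by blast
    from r_min[OF this] s(4) show ?thesis by simp
  qed
  have "degree r = 0"
  proof (rule ccontr)
    assume r_pos: "degree r \<noteq> 0"
    then obtain k q s where s: "coeffs_in A q" "coeffs_in A s" "smult (lead_coeff r ^ k) b = q * r + s"
      "degree s < degree r" "degree q \<le> degree b - degree r"
      using pseudo_division[OF A(1) r(1) _ b(1)] by blast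
    have "poly s x = lead_coeff r ^ k * poly b x - poly q x * poly r x"
      using arg_cong[OF s(3), of "\<lambda>p. poly p x"] by simp
    then have "poly s x - (- poly q x) * poly r x = lead_coeff r ^ k * poly b x" by simp
    also have "\<dots> \<in> M" using S' b(3) clS by (intro M_mult) auto
    finally have sx: "poly s x - (- poly q x) * poly r x \<in> M" .
    have sM: "poly s x \<in> M"
    proof (rule ccontr)
      assume "poly s x \<notin> M"
      then have "Q s" using multiple[OF s(2) _ clB(3)[OF pB[OF s(1)]] sx] by simp
      from r_min[OF this] s(4) show False by simp
    qed
    then have s_co: "coeffs_in M s" using b_min s(2,4) lt by simp
    have "(- poly q x) * poly r x \<in> M" using M_cong[OF sx] sM by blast
    then have "poly q x * poly r x \<in> M" by (metis M_uminus minus_minus mult_minus_left)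
    then have "poly q x \<in> M" using M_prime[of "poly q x" "poly r x"] pB[OF r(1)] pB[OF s(1)] BS rx by auto
    then have "coeffs_in M q" using b_min s(1,5) lt r_pos by simp
    then have "coeffs_in M (r * q)" using coeffs_in_M_mult cS r(1) by blast
    then have "coeffs_in M (smult (lead_coeff r ^ k) b)"
      using s_co unfolding s(3) by (auto simp: coeffs_in_def M_add mult.commute)
    then have "coeff (smult (lead_coeff r ^ k) b) (degree b) \<in> M" unfolding coeffs_in_def by blast
    then have "lead_coeff r ^ k * lead_coeff b \<in> M" by simp
    then show False
      using M_prime[of "lead_coeff r ^ k" "lead_coeff b"] power_notin_M[OF S'(1) r(2), of k]
        S'(2) b(2) clS(7)[OF S'(1), of k] by blast
  qed
  then obtain e where "r = [:e:]" by (rule degree_eq_zeroE)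
  then have "e \<in> A - M" "e - u * f \<in> M"
    using r(1) ru rx unfolding coeffs_in_def by (auto dest: spec[of _ "0::nat"])
  then show ?thesis using u by blast
qed

text \<open>By \<open>multiple_in_base\<close>, \<open>f\<close> divides some nonzero \<open>e \<in> A\<close>, so that \<open>e\<close> has the property of \<open>f\<close>
in \<open>A[x]\<close>. If \<open>c \<in> A\<close> divides \<open>e ^ N\<close> with quotient in \<open>A[x]\<close>, reduction of the quotient
modulo the minimal relation, with leading coefficient \<open>l\<close>, expresses \<open>l ^ k * e ^ N\<close> as \<open>c\<close> times
a combination of powers of \<open>x\<close> that are linearly independent over \<open>A\<close>. Comparing constant terms
shows that \<open>c\<close> divides \<open>l ^ k * e ^ N\<close> in \<open>A\<close>. Hence \<open>l * e\<close> works for \<open>A\<close>.\<close>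

lemma goldman_adjoin_imp_goldman:
  assumes A: "unital_subring A" "A \<subseteq> S" and x: "x \<in> S" and G: "goldman (adjoin A x)"
  shows "goldman A"
proof -
  let ?B = "adjoin A x"
  have B: "unital_subring ?B" using A by (intro unital_subring_adjoin)
  have BS: "?B \<subseteq> S"
    using S A x by (intro adjoin_subset)
  note cl = coeffs_in_closed[OF A(1)] unital_subringD[OF A(1)]
  note clB = unital_subringD[OF B] and clS = unital_subringD[OF S]
  obtain b where b: "coeffs_in A b" "lead_coeff b \<notin> M" "poly b x \<in> M" "degree b > 0"
    and b_min: "\<And>p. coeffs_in A p \<Longrightarrow> poly p x \<in> M \<Longrightarrow> degree p < degree b \<Longrightarrow> coeffs_in M p"
    using minimal_relation[OF A x goldman_adjoin_imp_algebraic[OF A x G]] by blast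
  obtain f where f: "f \<in> ?B" "f \<notin> M" "\<And>c. c \<in> ?B \<Longrightarrow> c \<notin> M \<Longrightarrow> \<exists>N. \<exists>h\<in>?B. f ^ N - c * h \<in> M"
    using G by (auto simp: goldman_def)
  obtain e u where e: "e \<in> A" "e \<notin> M" "u \<in> ?B" "e - u * f \<in> M"
    using multiple_in_base[OF A x b b_min f(1,2)] by blast
  define l where "l = lead_coeff b"
  have l: "l \<in> A" "l \<notin> M" using b by (auto simp: l_def coeffs_in_def)
  have S': "e \<in> S" "l \<in> S" "u \<in> S" "f \<in> S" using e l f A BS by auto
  show ?thesis
    unfolding goldman_def
  proof (intro bexI[of _ "l * e"] ballI)
    show "l * e \<in> A - M" using e l A M_prime S' by (auto intro: cl)
    fix c assume c: "c \<in> A - M"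
    then have cS: "c \<in> S" "c \<in> ?B" using A subset_adjoin by blast+
    then obtain N h where h: "h \<in> ?B" "f ^ N - c * h \<in> M" using f(3)[of c] c by blast
    have hS: "h \<in> S" using h BS by blast
    obtain H where H: "coeffs_in A H" "u ^ N * h = poly H x"
      using clB(6)[OF clB(7)[OF e(3)] h(1)] by (auto simp: adjoin_def)
    obtain k q s where s: "coeffs_in A q" "coeffs_in A s" "smult (l ^ k) H = q * b + s"
      "degree s < degree b"
      using pseudo_division[OF A(1) b(1,4) H(1)] unfolding l_def by blast
    have "e ^ N - u ^ N * f ^ N \<in> M"
      using cong_power[OF e(4), of N] S' clS by (simp add: power_mult_distrib)
    moreover have "u ^ N * f ^ N - c * poly H x = u ^ N * (f ^ N - c * h)"
      by (simp add: H(2)[symmetric] algebra_simps)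
    then have "u ^ N * f ^ N - c * poly H x \<in> M"
      using h(2) S' clS by (auto intro!: M_mult)
    ultimately have eH: "e ^ N - c * poly H x \<in> M" by (rule cong_trans)
    have "l ^ k * poly H x = poly q x * poly b x + poly s x"
      using arg_cong[OF s(3), of "\<lambda>p. poly p x"] by simp
    then have "poly ([:l ^ k * e ^ N:] - smult c s) x =
        l ^ k * (e ^ N - c * poly H x) + c * poly q x * poly b x"
      by (simp add: algebra_simps)
    also have "\<dots> \<in> M"
      using eH b(3) S' cS BS clS s(1) by (intro M_add M_mult) (auto simp: adjoin_def)
    finally have "poly ([:l ^ k * e ^ N:] - smult c s) x \<in> M" .
    moreover have "degree ([:l ^ k * e ^ N:] - smult c s) < degree b"
      using s(4) degree_smult_le[of c s] b(4) by (intro degree_diff_less) auto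
    moreover have "coeffs_in A ([:l ^ k * e ^ N:] - smult c s)"
      using c by (auto intro!: cl s e l)
    ultimately have "coeffs_in M ([:l ^ k * e ^ N:] - smult c s)" by (intro b_min)
    then have "coeff ([:l ^ k * e ^ N:] - smult c s) 0 \<in> M" unfolding coeffs_in_def by blast
    then have "l ^ k * e ^ N - c * coeff s 0 \<in> M" by simp
    then have "(l ^ N * e ^ k) * (l ^ k * e ^ N - c * coeff s 0) \<in> M"
      using S' clS by (intro M_mult) auto
    also have "(l ^ N * e ^ k) * (l ^ k * e ^ N - c * coeff s 0) =
      (l * e) ^ (N + k) - c * (l ^ N * e ^ k * coeff s 0)"
      by (simp add: algebra_simps power_add power_mult_distrib)
    finally have "(l * e) ^ (N + k) - c * (l ^ N * e ^ k * coeff s 0) \<in> M" .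
    moreover have "l ^ N * e ^ k * coeff s 0 \<in> A" using s(2) by (intro cl l e) (auto simp: coeffs_in_def)
    ultimately show "\<exists>N. \<exists>h\<in>A. (l * e) ^ N - c * h \<in> M" by blast
  qed
qed

end

section \<open>Characters of monoid algebras and their kernels\<close>

inductive_set sums_of :: "'a::comm_monoid_add set \<Rightarrow> 'a set" for G where
  zero: "0 \<in> sums_of G"
| plus: "g \<in> G \<Longrightarrow> s \<in> sums_of G \<Longrightarrow> g + s \<in> sums_of G"

lemma sums_of_add: "a \<in> sums_of G \<Longrightarrow> b \<in> sums_of G \<Longrightarrow> a + b \<in> sums_of G"
  by (induction rule: sums_of.induct) (auto simp: add.assoc intro: sums_of.intros)

lemma sums_of_sum: "(\<And>x. x \<in> X \<Longrightarrow> f x \<in> sums_of G) \<Longrightarrow> sum f X \<in> sums_of G"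
  by (induction X rule: infinite_finite_induct) (auto intro: sums_of.zero sums_of_add)

lemma in_carrier_monoid_algebra: "p \<in> carrier (monoid_algebra S) \<longleftrightarrow> Poly_Mapping.keys p \<subseteq> S"
  by (simp add: monoid_algebra_def)

lemma monoid_algebra_ops:
  "monoid.mult (monoid_algebra S) = (*)" "one (monoid_algebra S) = 1"
  "add (monoid_algebra S) = (+)" "zero (monoid_algebra S) = 0"
  by (simp_all add: monoid_algebra_def)

lemma const_sum: "const (sum f X) = (\<Sum>x\<in>X. const (f x))"
  by (induction X rule: infinite_finite_induct) (simp_all add: single_add)

lemma keys_minus_subset: "Poly_Mapping.keys (p - q) \<subseteq> Poly_Mapping.keys p \<union> Poly_Mapping.keys q"
  for p q :: "'a \<Rightarrow>\<^sub>0 'k::ab_group_add"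
  by (auto simp: in_keys_iff lookup_minus)

lemma unital_subring_monoid_algebra:
  assumes "0 \<in> S" "\<And>a b. a \<in> S \<Longrightarrow> b \<in> S \<Longrightarrow> a + b \<in> S"
  shows "unital_subring (carrier (monoid_algebra S) :: ('a::comm_monoid_add \<Rightarrow>\<^sub>0 'k::comm_ring_1) set)"
  unfolding unital_subring_def in_carrier_monoid_algebra
proof (intro conjI ballI)
  show "Poly_Mapping.keys (1 :: 'a \<Rightarrow>\<^sub>0 'k) \<subseteq> S" using assms(1) by simp
next
  fix p q :: "'a \<Rightarrow>\<^sub>0 'k"
  assume "p \<in> carrier (monoid_algebra S)" "q \<in> carrier (monoid_algebra S)"
  then have pq: "Poly_Mapping.keys p \<subseteq> S" "Poly_Mapping.keys q \<subseteq> S"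
    by (simp_all add: in_carrier_monoid_algebra)
  show "Poly_Mapping.keys (p - q) \<subseteq> S" using pq keys_minus_subset[of p q] by blast
  show "Poly_Mapping.keys (p * q) \<subseteq> S" using pq keys_mult[of p q] assms(2) by blast
qed

lemma ideal_monoid_algebraD:
  assumes "ideal I (monoid_algebra S)"
  shows "I \<subseteq> carrier (monoid_algebra S)" "0 \<in> I"
    "a \<in> I \<Longrightarrow> b \<in> I \<Longrightarrow> a + b \<in> I"
    "c \<in> carrier (monoid_algebra S) \<Longrightarrow> a \<in> I \<Longrightarrow> c * a \<in> I"
    "(\<And>x. x \<in> X \<Longrightarrow> f x \<in> I) \<Longrightarrow> sum f X \<in> I"
proof -
  interpret ideal I "monoid_algebra S" by fact
  show "I \<subseteq> carrier (monoid_algebra S)" by (auto intro: Icarr)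
  show z: "0 \<in> I" using additive_subgroup.zero_closed[OF ideal.axioms(1)[OF assms]] by (simp add: monoid_algebra_ops)
  have add: "a + b \<in> I" if "a \<in> I" "b \<in> I" for a b
    using additive_subgroup.a_closed[OF ideal.axioms(1)[OF assms] that] by (simp add: monoid_algebra_ops)
  then show "a \<in> I \<Longrightarrow> b \<in> I \<Longrightarrow> a + b \<in> I" .
  show "c \<in> carrier (monoid_algebra S) \<Longrightarrow> a \<in> I \<Longrightarrow> c * a \<in> I"
    using I_l_closed[of a c] by (simp add: monoid_algebra_ops)
  show "(\<And>x. x \<in> X \<Longrightarrow> f x \<in> I) \<Longrightarrow> sum f X \<in> I"
    by (induction X rule: infinite_finite_induct) (auto simp: z add)
qed

text \<open>A character \<open>\<chi>\<close> of a monoid extends to the evaluation \<open>lin_ext \<chi>\<close> on the monoid algebra. Points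
of the affine space and points of the spectrum of the tableaux algebra are both treated as such
characters, and \<open>G\<close> is the set of generators whose values serve as coordinates.\<close>

locale algebra_character =
  fixes S :: "'a::comm_monoid_add set" and G :: "'a set" and \<chi> :: "'a \<Rightarrow> 'k::comm_ring_1"
  assumes zero_in_S: "0 \<in> S" and plus_in_S: "a \<in> S \<Longrightarrow> b \<in> S \<Longrightarrow> a + b \<in> S"
    and G_sub: "G \<subseteq> S" and S_sub: "S \<subseteq> sums_of G"
    and chi_zero: "\<chi> 0 = 1" and chi_plus: "\<chi> (a + b) = \<chi> a * \<chi> b"
begin

abbreviation "R \<equiv> monoid_algebra S :: ('a \<Rightarrow>\<^sub>0 'k) ring"

definition "Ker = {p \<in> carrier R. lin_ext \<chi> p = 0}"

lemma cring_R: "cring R"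
  by (intro cring_monoid_algebra zero_in_S plus_in_S)

lemma single_in_carrier: "a \<in> S \<Longrightarrow> Poly_Mapping.single a c \<in> carrier R"
  by (simp add: in_carrier_monoid_algebra)

lemma ideal_Ker: "ideal Ker R"
  unfolding Ker_def by (intro kernel_ideal cring_R chi_plus)

text \<open>Modulo an ideal that contains all \<open>g - \<chi> g\<close> every element of the algebra is congruent to its
value: a monomial \<open>g + s\<close> by the identity \<open>gs - ab = g (s - b) + b (g - a)\<close>, and then every
linear combination of monomials.\<close>

lemma minus_value_in_ideal:
  assumes I: "ideal I R" and gen: "\<And>g. g \<in> G \<Longrightarrow> Poly_Mapping.single g 1 - const (\<chi> g) \<in> I"
    and p: "p \<in> carrier R"
  shows "p - const (lin_ext \<chi> p) \<in> I"
proof -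
  note ID = ideal_monoid_algebraD[OF I]
  have mono: "Poly_Mapping.single s 1 - const (\<chi> s) \<in> I" if "s \<in> sums_of G" for s
    using that
  proof induction
    case zero
    then show ?case using ID(2) by (simp add: chi_zero)
  next
    case (plus g s)
    have "Poly_Mapping.single (g + s) 1 - const (\<chi> (g + s)) =
      Poly_Mapping.single g 1 * (Poly_Mapping.single s 1 - const (\<chi> s)) +
      const (\<chi> s) * (Poly_Mapping.single g 1 - const (\<chi> g))"
      by (simp add: chi_plus right_diff_distrib mult_single mult.commute)
    also have "\<dots> \<in> I"
      using plus.hyps G_sub zero_in_S by (intro ID(3,4) plus.IH gen single_in_carrier) auto
    finally show ?case .
  qed
  have "p - const (lin_ext \<chi> p) = (\<Sum>a\<in>Poly_Mapping.keys p.
      const (Poly_Mapping.lookup p a) * (Poly_Mapping.single a 1 - const (\<chi> a)))"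
    by (simp add: lin_ext_def const_sum right_diff_distrib mult_single sum_subtractf
        flip: sum_single_keys)
  also have "\<dots> \<in> I"
    using p S_sub by (intro ID(4,5) single_in_carrier mono zero_in_S) (auto simp: in_carrier_monoid_algebra)
  finally show ?thesis .
qed

lemma genideal_eq_Ker:
  "genideal R {Poly_Mapping.single g 1 - const (\<chi> g) | g. g \<in> G} = Ker"
proof -
  interpret cring R by (rule cring_R)
  let ?X = "{Poly_Mapping.single g 1 - const (\<chi> g) | g. g \<in> G}"
  have XK: "?X \<subseteq> Ker"
  proof safe
    fix g assume "g \<in> G"
    then have "Poly_Mapping.single g 1 - const (\<chi> g) \<in> carrier R"
      using G_sub zero_in_S unital_subringD(5)[OF unital_subring_monoid_algebra[OF zero_in_S plus_in_S]]
        single_in_carrier by blast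
    then show "Poly_Mapping.single g 1 - const (\<chi> g) \<in> Ker"
      by (simp add: Ker_def lin_ext_diff chi_zero)
  qed
  then have X: "?X \<subseteq> carrier R" by (auto simp: Ker_def)
  show ?thesis
  proof
    show "genideal R ?X \<subseteq> Ker" by (rule genideal_minimal[OF ideal_Ker XK])
    show "Ker \<subseteq> genideal R ?X"
    proof
      fix p assume p: "p \<in> Ker"
      have "p - const (lin_ext \<chi> p) \<in> genideal R ?X"
        using genideal_self[OF X] p
        by (intro minus_value_in_ideal genideal_ideal[OF X]) (auto simp: Ker_def)
      then show "p \<in> genideal R ?X" using p by (simp add: Ker_def)
    qed
  qed
qed

end

locale field_character = algebra_character S G \<chi>
  for S :: "'a::comm_monoid_add set" and G :: "'a set" and \<chi> :: "'a \<Rightarrow> 'k::field"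
begin

lemma ideal_with_unit:
  assumes J: "ideal J R" and c: "const c \<in> J" "c \<noteq> 0"
  shows "J = carrier R"
proof -
  have "const (inverse c) * const c \<in> J"
    using c single_in_carrier zero_in_S by (intro ideal_monoid_algebraD(4)[OF J]) auto
  then have "\<one>\<^bsub>R\<^esub> \<in> J" using c(2) by (simp add: mult_single monoid_algebra_ops)
  then show ?thesis by (rule ideal.one_imp_carrier[OF J])
qed

text \<open>An element outside the kernel differs from a nonzero constant, its value, by an element of the
kernel.\<close>

lemma ideal_over_Ker:
  assumes J: "ideal J R" and "Ker \<subseteq> J"
  shows "J = Ker \<or> J = carrier R"
proof (cases "J \<subseteq> Ker")
  case False
  then obtain p where p: "p \<in> J" "p \<notin> Ker" by blast
  then have pc: "p \<in> carrier R" using ideal_monoid_algebraD(1)[OF J] by blast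
  let ?c = "lin_ext \<chi> p"
  have c: "?c \<noteq> 0" using p pc by (simp add: Ker_def)
  have "const ?c - p \<in> carrier R"
    using unital_subringD(5)[OF unital_subring_monoid_algebra[OF zero_in_S plus_in_S]]
      single_in_carrier zero_in_S pc by blast
  then have "const ?c - p \<in> Ker" by (simp add: Ker_def lin_ext_diff chi_zero)
  then have "(const ?c - p) + p \<in> J"
    using p assms(2) by (intro ideal_monoid_algebraD(3)[OF J]) auto
  then show ?thesis using ideal_with_unit[OF J _ c] by simp
qed (use assms in blast)

lemma maximalideal_Ker: "maximalideal Ker R"
proof (rule maximalidealI[OF ideal_Ker])
  have "1 \<in> carrier R" using zero_in_S by (simp add: in_carrier_monoid_algebra)
  moreover have "lin_ext \<chi> 1 = 1" using lin_ext_single[of \<chi> 0 1] by (simp add: chi_zero)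
  ultimately have "1 \<in> carrier R - Ker" by (simp add: Ker_def)
  then show "carrier R \<noteq> Ker" by blast
qed (use ideal_over_Ker in blast)

end

lemma maximalideal_inverse:
  fixes R (structure)
  assumes "cring R" and M: "maximalideal M R" and c: "c \<in> carrier R" "c \<notin> M"
  shows "\<exists>h\<in>carrier R. \<exists>m\<in>M. \<one> = m \<oplus> h \<otimes> c"
proof -
  interpret cring R by fact
  interpret M: maximalideal M R by fact
  let ?J = "M <+>\<^bsub>R\<^esub> PIdl\<^bsub>R\<^esub> c"
  have J: "ideal ?J R" by (intro add_ideals M.ideal_axioms cgenideal_ideal c)
  have J_eq: "?J = (\<Union>m\<in>M. \<Union>h\<in>carrier R. {m \<oplus> h \<otimes> c})"
    unfolding set_add_def' cgenideal_def by auto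
  have "M \<subseteq> ?J"
  proof
    fix m assume m: "m \<in> M"
    then have "m = m \<oplus> \<zero> \<otimes> c" using M.Icarr c(1) by simp
    then show "m \<in> ?J" unfolding J_eq using m zero_closed by blast
  qed
  moreover have "c = \<zero> \<oplus> \<one> \<otimes> c" using c(1) by simp
  then have "c \<in> ?J" unfolding J_eq using M.zero_closed one_closed by blast
  ultimately have "?J = carrier R"
    using M.I_maximal[OF J] c(2) ideal.Icarr[OF J] by blast
  then have "\<one> \<in> ?J" by simp
  then show ?thesis unfolding J_eq by blast
qed

lemma maximalideal_prime_in_subring:
  assumes "0 \<in> S" "\<And>a b. a \<in> S \<Longrightarrow> b \<in> S \<Longrightarrow> a + b \<in> S"
    and M: "maximalideal M (monoid_algebra S :: ('a::comm_monoid_add \<Rightarrow>\<^sub>0 'k::comm_ring_1) ring)"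
  shows "prime_in_subring (carrier (monoid_algebra S)) M"
proof -
  let ?R = "monoid_algebra S :: ('a \<Rightarrow>\<^sub>0 'k) ring"
  interpret cring ?R using assms by (intro cring_monoid_algebra)
  interpret M: maximalideal M ?R by fact
  interpret P: primeideal M ?R by (rule maximalideal_prime[OF M])
  note D = ideal_monoid_algebraD[OF M.ideal_axioms]
  show ?thesis
  proof
    show "unital_subring (carrier ?R)" by (intro unital_subring_monoid_algebra assms)
    show "1 \<notin> M" using M.one_imp_carrier M.I_notcarr by (auto simp: monoid_algebra_ops)
    show "a \<in> M \<or> b \<in> M" if "a \<in> carrier ?R" "b \<in> carrier ?R" "a * b \<in> M" for a b
      using P.I_prime[OF that(1,2)] that(3) by (simp add: monoid_algebra_ops)
  qed (use D in auto)
qed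

section \<open>Maximal ideals of polynomial rings\<close>

definition polys_in :: "(nat \<times> nat) set \<Rightarrow> ((nat \<times> nat \<Rightarrow>\<^sub>0 nat) \<Rightarrow>\<^sub>0 'k::comm_ring_1) set" where
  "polys_in V = carrier (monoid_algebra {e. Poly_Mapping.keys e \<subseteq> V})"

lemma exponents_add:
  fixes a b :: "'v \<Rightarrow>\<^sub>0 nat"
  shows "a \<in> {e. Poly_Mapping.keys e \<subseteq> V} \<Longrightarrow> b \<in> {e. Poly_Mapping.keys e \<subseteq> V} \<Longrightarrow>
    a + b \<in> {e. Poly_Mapping.keys e \<subseteq> V}"
  using Poly_Mapping.keys_add[of a b] by blast

lemma exponents_generated:
  "{e :: 'v \<Rightarrow>\<^sub>0 nat. Poly_Mapping.keys e \<subseteq> V} \<subseteq> sums_of ((\<lambda>v. Poly_Mapping.single v 1) ` V)"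
proof
  fix e :: "'v \<Rightarrow>\<^sub>0 nat" assume e: "e \<in> {e. Poly_Mapping.keys e \<subseteq> V}"
  have *: "Poly_Mapping.single v k \<in> sums_of ((\<lambda>v. Poly_Mapping.single v 1) ` V)" if "v \<in> V" for v :: 'v and k :: nat
  proof (induction k)
    case (Suc k)
    have "Poly_Mapping.single v (Suc k) = Poly_Mapping.single v 1 + Poly_Mapping.single v k"
      by (simp flip: single_add)
    then show ?case using Suc that by (auto intro: sums_of.plus)
  qed (simp add: sums_of.zero)
  show "e \<in> sums_of ((\<lambda>v. Poly_Mapping.single v 1) ` V)"
    by (subst sum_single_keys) (use e in \<open>auto intro!: sums_of_sum * simp del: One_nat_def\<close>)
qed

lemma unital_subring_polys_in: "unital_subring (polys_in V)"
  unfolding polys_in_def by (intro unital_subring_monoid_algebra exponents_add) auto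

lemma polys_in_mono: "V \<subseteq> W \<Longrightarrow> polys_in V \<subseteq> polys_in W"
  unfolding polys_in_def subset_iff in_carrier_monoid_algebra by blast

lemma xvar_power: "xvar i j ^ k = Poly_Mapping.single (Poly_Mapping.single (i, j) k) 1"
  by (induction k) (simp_all add: xvar_def mult_single flip: single_add)

lemma xvar_in_polys_in: "(i, j) \<in> V \<Longrightarrow> xvar i j \<in> polys_in V"
  by (simp add: polys_in_def in_carrier_monoid_algebra xvar_def)

lemma adjoin_variable:
  "(adjoin (polys_in V) (xvar i j) :: (_ \<Rightarrow>\<^sub>0 'k::comm_ring_1) set) =
    polys_in (insert (i, j) V)"
proof
  show "(adjoin (polys_in V) (xvar i j) :: (_ \<Rightarrow>\<^sub>0 'k) set) \<subseteq> polys_in (insert (i, j) V)"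
    by (intro adjoin_subset unital_subring_polys_in xvar_in_polys_in polys_in_mono) auto
  note A = unital_subringD[OF unital_subring_adjoin[OF unital_subring_polys_in]]
  show "(polys_in (insert (i, j) V) :: (_ \<Rightarrow>\<^sub>0 'k) set) \<subseteq> adjoin (polys_in V) (xvar i j)"
  proof
    fix p :: "(nat \<times> nat \<Rightarrow>\<^sub>0 nat) \<Rightarrow>\<^sub>0 'k" assume p: "p \<in> polys_in (insert (i, j) V)"
    have "Poly_Mapping.single e c \<in> adjoin (polys_in V) (xvar i j)"
      if e: "Poly_Mapping.keys e \<subseteq> insert (i, j) V" for e and c :: 'k
    proof -
      let ?k = "Poly_Mapping.lookup e (i, j)"
      define e' where "e' = e - Poly_Mapping.single (i, j) ?k"
      have e': "e = e' + Poly_Mapping.single (i, j) ?k"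
        by (rule poly_mapping_eqI) (auto simp: e'_def lookup_add lookup_minus lookup_single when_def)
      have "Poly_Mapping.keys e' \<subseteq> V"
        using e by (auto simp: e'_def in_keys_iff subset_iff lookup_minus lookup_single when_def
            split: if_splits)
      then have "Poly_Mapping.single e' c \<in> polys_in V"
        by (simp add: polys_in_def in_carrier_monoid_algebra)
      moreover have "Poly_Mapping.single e c = Poly_Mapping.single e' c * xvar i j ^ ?k"
        by (subst e') (simp add: xvar_power mult_single)
      ultimately show ?thesis
        using subset_adjoin[OF unital_subring_polys_in] generator_in_adjoin[OF unital_subring_polys_in]
        by (auto intro!: A)
    qed
    moreover have "Poly_Mapping.keys p \<subseteq> {e. Poly_Mapping.keys e \<subseteq> insert (i, j) V}"
      using p by (simp add: polys_in_def in_carrier_monoid_algebra)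
    ultimately show "p \<in> adjoin (polys_in V) (xvar i j)"
      by (subst sum_single_keys) (intro A(8), blast)
  qed
qed

text \<open>The variables are removed one at a time, in any order; keeping a prescribed one for last makes it
possible to treat each variable separately.\<close>

lemma goldman_fewer_variables:
  fixes M :: "((nat \<times> nat \<Rightarrow>\<^sub>0 nat) \<Rightarrow>\<^sub>0 'k::comm_ring_1) set"
  assumes P: "prime_in_subring S M"
    and "finite D" "prime_in_subring.goldman M (polys_in (V \<union> D))" "polys_in (V \<union> D) \<subseteq> S"
  shows "prime_in_subring.goldman M (polys_in V)"
  using assms(2-)
proof (induction D)
  case (insert v D)
  interpret prime_in_subring S M by fact
  obtain i j where v: "v = (i, j)" by (cases v)
  have "polys_in (V \<union> D) \<subseteq> polys_in (V \<union> insert v D)" by (intro polys_in_mono) auto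
  moreover have "xvar i j \<in> polys_in (V \<union> insert v D)" by (intro xvar_in_polys_in) (simp add: v)
  moreover have "goldman (adjoin (polys_in (V \<union> D)) (xvar i j))"
    using insert.prems by (simp add: adjoin_variable v)
  ultimately show ?case
    using insert.prems insert.IH goldman_adjoin_imp_goldman[OF unital_subring_polys_in] by blast
qed simp

lemma const_mult: "const (a * b) = (const a * const b :: 'a::comm_monoid_add \<Rightarrow>\<^sub>0 'k::comm_ring_1)"
  by (simp add: mult_single)

lemma poly_map_const_linear_factor:
  fixes x :: "'a::comm_monoid_add \<Rightarrow>\<^sub>0 'k::comm_ring_1"
  shows "poly (map_poly const ([:- c, 1:] * q)) x = (x - const c) * poly (map_poly const q) x"
proof -
  have eq: "map_poly const ([:- c, 1:] * q) = [:- const c, 1:] * (map_poly const q :: ('a \<Rightarrow>\<^sub>0 'k) poly)"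
    by (rule poly_eqI)
      (auto simp: coeff_map_poly coeff_pCons single_uminus single_diff const_mult split: nat.split)
  show ?thesis unfolding eq by (simp add: algebra_simps)
qed

text \<open>Over an algebraically closed field a relation for \<open>x\<close> modulo a prime splits into linear factors,
one of which must vanish.\<close>

lemma linear_factor_in_prime:
  fixes M :: "('a::comm_monoid_add \<Rightarrow>\<^sub>0 'k::alg_closed_field) set"
  assumes P: "prime_in_subring S M" and const_in_S: "\<And>c. const c \<in> S" and x: "x \<in> S"
    and q: "q \<noteq> 0" "poly (map_poly const q) x \<in> M"
  shows "\<exists>c. x - const c \<in> M"
  using q
proof (induction "degree q" arbitrary: q)
  case 0
  interpret prime_in_subring S M by fact
  obtain c where c: "q = [:c:]" using 0 degree_eq_zeroE[of q] by metis
  with 0 have "c \<noteq> 0" "const c \<in> M" by (simp_all add: map_poly_pCons)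
  then have "const (inverse c) * const c \<in> M" by (intro M_mult const_in_S)
  with \<open>c \<noteq> 0\<close> show ?case using one_notin_M by (simp add: mult_single)
next
  case (Suc d)
  interpret prime_in_subring S M by fact
  obtain c where "poly q c = 0" using alg_closed_imp_poly_has_root[of q] Suc(2) by auto
  then obtain r where r: "q = [:- c, 1:] * r" by (auto simp: poly_eq_0_iff_dvd)
  then have r0: "r \<noteq> 0" using Suc.prems by auto
  have "(x - const c) * poly (map_poly const r) x \<in> M"
    using Suc.prems(2) unfolding r poly_map_const_linear_factor .
  moreover have "x - const c \<in> S" by (intro unital_subringD[OF S] x const_in_S)
  moreover have "poly (map_poly const r) x \<in> S"
    by (intro poly_mem[OF S] x) (simp add: coeffs_in_def coeff_map_poly const_in_S)
  ultimately consider "x - const c \<in> M" | "poly (map_poly const r) x \<in> M"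
    using M_prime by blast
  then show ?case
  proof cases
    case 2
    have "degree q = Suc (degree r)" unfolding r using r0 by (subst degree_mult_eq) auto
    then show ?thesis using Suc.hyps 2 r0 by simp
  qed blast
qed

text \<open>The quotient by \<open>M\<close> is a field, hence a Goldman domain. Removing all variables but one from the
generators leaves a Goldman domain generated over the field of constants by that one variable,
which is therefore algebraic over the constants modulo \<open>M\<close>, hence congruent to a constant.\<close>

lemma maximalideal_contains_linear:
  fixes M :: "((nat \<times> nat \<Rightarrow>\<^sub>0 nat) \<Rightarrow>\<^sub>0 'k::alg_closed_field) set"
  assumes M: "maximalideal M (monoid_algebra {e. Poly_Mapping.keys e \<subseteq> W})"
    and W: "finite W" "(i, j) \<in> W"
  shows "\<exists>c. xvar i j - const c \<in> M"
proof -
  let ?E = "{e :: nat \<times> nat \<Rightarrow>\<^sub>0 nat. Poly_Mapping.keys e \<subseteq> W}"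
  let ?R = "monoid_algebra ?E :: ((nat \<times> nat \<Rightarrow>\<^sub>0 nat) \<Rightarrow>\<^sub>0 'k) ring"
  have P: "prime_in_subring (polys_in W) M"
    unfolding polys_in_def by (intro maximalideal_prime_in_subring M exponents_add) auto
  interpret prime_in_subring "polys_in W" M by (rule P)
  have "\<exists>h\<in>polys_in W. 1 ^ 0 - c * h \<in> M" if c: "c \<in> polys_in W - M" for c
  proof -
    have "cring ?R" by (intro cring_monoid_algebra exponents_add) auto
    from maximalideal_inverse[OF this M, of c] c
    obtain h m where h: "h \<in> polys_in W" "m \<in> M" "1 = m + h * c"
      by (auto simp: polys_in_def monoid_algebra_ops)
    then have "1 ^ 0 - c * h = m" by (simp add: algebra_simps)
    then show ?thesis using h by auto
  qed
  then have "goldman (polys_in W)"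
    unfolding goldman_def using unital_subringD(2)[OF S] one_notin_M by blast
  moreover have W_eq: "W = {(i, j)} \<union> (W - {(i, j)})" using W by blast
  ultimately have "goldman (polys_in {(i, j)})"
    using goldman_fewer_variables[OF P, of "W - {(i, j)}" "{(i, j)}"] W by auto
  then have G: "goldman (adjoin (polys_in {}) (xvar i j))" by (simp add: adjoin_variable)
  have x: "xvar i j \<in> polys_in W" by (rule xvar_in_polys_in[OF W(2)])
  obtain p where p: "coeffs_in (polys_in {}) p" "\<not> coeffs_in M p" "poly p (xvar i j) \<in> M"
    using goldman_adjoin_imp_algebraic[OF unital_subring_polys_in polys_in_mono x G] by blast
  \<comment> \<open>The elements of \<open>polys_in {}\<close> are the constants.\<close>
  define q where "q = map_poly (\<lambda>a. Poly_Mapping.lookup a 0) p"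
  have base: "const (Poly_Mapping.lookup a 0) = a" if "a \<in> polys_in {}" for a :: "(nat \<times> nat \<Rightarrow>\<^sub>0 nat) \<Rightarrow>\<^sub>0 'k"
  proof -
    have "Poly_Mapping.keys a \<subseteq> {0}"
      using that by (simp add: polys_in_def in_carrier_monoid_algebra)
    then show ?thesis
      by (intro poly_mapping_eqI) (auto simp: lookup_single when_def in_keys_iff subset_iff)
  qed
  have pq: "map_poly const q = p"
    by (rule poly_eqI) (use p(1) base in \<open>simp add: q_def coeff_map_poly coeffs_in_def\<close>)
  have "q \<noteq> 0" using p(2) M_zero pq by (auto simp: coeffs_in_def)
  moreover have "const c \<in> polys_in W" for c
    by (simp add: polys_in_def in_carrier_monoid_algebra)
  ultimately show ?thesis
    using linear_factor_in_prime[OF P _ x, of q] p(3) pq by auto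
qed

definition monomial_value :: "nat \<Rightarrow> nat \<Rightarrow> (nat \<Rightarrow> nat \<Rightarrow> 'k::comm_ring_1) \<Rightarrow> (nat \<times> nat \<Rightarrow>\<^sub>0 nat) \<Rightarrow> 'k" where
  "monomial_value n m \<alpha> e = (\<Prod>i=1..n. \<Prod>j=1..m. \<alpha> i j ^ Poly_Mapping.lookup e (i, j))"

lemma monomial_value_variable:
  assumes "i \<in> {1..n}" "j \<in> {1..m}"
  shows "monomial_value n m \<alpha> (Poly_Mapping.single (i, j) 1) = \<alpha> i j"
proof -
  have "monomial_value n m \<alpha> (Poly_Mapping.single (i, j) 1) =
     (\<Prod>k=1..n. \<Prod>l=1..m. if l = j then (if k = i then \<alpha> i j else 1) else 1)"
    unfolding monomial_value_def by (intro prod.cong refl) (auto simp: lookup_single when_def)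
  then show ?thesis using assms by (simp add: prod.delta)
qed

lemma poly_ring_character:
  "field_character {e :: nat \<times> nat \<Rightarrow>\<^sub>0 nat. Poly_Mapping.keys e \<subseteq> {1..n} \<times> {1..m}}
    ((\<lambda>v. Poly_Mapping.single v 1) ` ({1..n} \<times> {1..m})) (monomial_value n m \<alpha>)"
  by (intro field_character.intro algebra_character.intro exponents_generated exponents_add)
    (auto simp: monomial_value_def lookup_add power_add prod.distrib)

lemma N_ideal_eq_kernel:
  fixes \<alpha> :: "nat \<Rightarrow> nat \<Rightarrow> 'k::field"
  shows "N_ideal n m \<alpha> = {p \<in> carrier (poly_ring n m). lin_ext (monomial_value n m \<alpha>) p = 0}"
proof -
  interpret field_character "{e :: nat \<times> nat \<Rightarrow>\<^sub>0 nat. Poly_Mapping.keys e \<subseteq> {1..n} \<times> {1..m}}"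
    "(\<lambda>v. Poly_Mapping.single v 1) ` ({1..n} \<times> {1..m})" "monomial_value n m \<alpha>"
    by (rule poly_ring_character)
  have "{xvar i j - const (\<alpha> i j) | i j. i \<in> {1..n} \<and> j \<in> {1..m}} =
    {Poly_Mapping.single g 1 - const (monomial_value n m \<alpha> g) | g.
       g \<in> (\<lambda>v. Poly_Mapping.single v 1) ` ({1..n} \<times> {1..m})}"
    by (force simp: xvar_def monomial_value_variable simp del: One_nat_def)
  then show ?thesis
    unfolding N_ideal_def poly_ring_def by (simp only: genideal_eq_Ker Ker_def)
qed

text \<open>A maximal ideal contains \<open>x - c\<close> for each variable \<open>x\<close> and a suitable constant \<open>c\<close>, and the
ideal generated by these differences is already maximal.\<close>

theorem weak_nullstellensatz:
  fixes M :: "((nat \<times> nat \<Rightarrow>\<^sub>0 nat) \<Rightarrow>\<^sub>0 'k::alg_closed_field) set"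
  assumes M: "maximalideal M (poly_ring n m)"
  shows "\<exists>\<alpha>. M = N_ideal n m \<alpha>"
proof -
  let ?W = "{1..n} \<times> {1..m}"
  have "\<forall>i j. \<exists>c. (i, j) \<in> ?W \<longrightarrow> xvar i j - const c \<in> M"
    using maximalideal_contains_linear[OF M[unfolded poly_ring_def]] by auto
  then obtain \<alpha> where \<alpha>: "\<And>i j. (i, j) \<in> ?W \<Longrightarrow> xvar i j - const (\<alpha> i j) \<in> M"
    by metis
  interpret field_character "{e :: nat \<times> nat \<Rightarrow>\<^sub>0 nat. Poly_Mapping.keys e \<subseteq> ?W}"
    "(\<lambda>v. Poly_Mapping.single v 1) ` ?W" "monomial_value n m \<alpha>"
    by (rule poly_ring_character)
  interpret M: maximalideal M R using M by (simp add: poly_ring_def)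
  interpret cring R by (rule cring_R)
  have "N_ideal n m \<alpha> \<subseteq> M"
    unfolding N_ideal_def poly_ring_def using \<alpha> by (intro M.genideal_minimal M.ideal_axioms) auto
  then have "M = Ker \<or> M = carrier R"
    unfolding N_ideal_eq_kernel poly_ring_def Ker_def[symmetric]
    by (intro ideal_over_Ker M.ideal_axioms)
  then have "M = Ker" using M.I_notcarr by blast
  then show ?thesis
    unfolding N_ideal_eq_kernel poly_ring_def Ker_def by blast
qed

section \<open>Tableaux are sums of columns\<close>

lemma row_0 [simp]: "row T 0 = []"
  by transfer simp

lemma fits_rows: "fits (row T (Suc i)) (row T (Suc (Suc i)))"
  by transfer (simp add: is_ssyt_iff)

lemma zero_notin_row: "0 \<notin> set (row T i)"
  by (cases i; transfer; simp add: is_ssyt_iff)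

lemma row_antimono: "i \<le> j \<Longrightarrow> length (row T (Suc j)) \<le> length (row T (Suc i))"
  by (rule lift_Suc_antimono_le[of "\<lambda>i. length (row T (Suc i))"])
    (use fits_rows in \<open>auto simp: fits_def\<close>)

text \<open>A tableau can be given by its rows as a function of the row number, without regard to where the
nonempty rows end.\<close>

lemma ssyt_of_rows:
  fixes f :: "nat \<Rightarrow> nat list"
  assumes "f 0 = []" "\<And>i. i > n \<Longrightarrow> f i = []" "\<And>i. 0 \<notin> set (f i)" "\<And>i. sorted (f i)"
    "\<And>i. fits (f (Suc i)) (f (Suc (Suc i)))"
  obtains T where "\<And>i. row T i = f i"
proof -
  define xs where "xs = takeWhile (\<lambda>r. r \<noteq> []) (map (\<lambda>i. f (Suc i)) [0..<n])"
  have anti: "length (f (Suc j)) \<le> length (f (Suc i))" if "i \<le> j" for i j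
    using that by (rule lift_Suc_antimono_le[of "\<lambda>i. length (f (Suc i))", rotated])
      (use assms(5) in \<open>auto simp: fits_def\<close>)
  have len: "length xs \<le> n"
    unfolding xs_def using length_takeWhile_le[of _ "map (\<lambda>i. f (Suc i)) [0..<n]"] by auto
  have nth: "xs ! i = f (Suc i)" if "i < length xs" for i
    using that len unfolding xs_def by (subst takeWhile_nth) auto
  have empty: "f (Suc i) = []" if "i \<ge> length xs" for i
  proof -
    have "f (Suc (length xs)) = []"
    proof (cases "length xs < n")
      case True
      then show ?thesis
        using nth_length_takeWhile[of "\<lambda>r. r \<noteq> []" "map (\<lambda>i. f (Suc i)) [0..<n]"]
        by (simp add: xs_def)
    qed (use len assms(2) in simp)
    then show ?thesis using anti[OF that] by simp
  qed
  have row: "row_of xs i = f i" for i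
    using nth empty assms(1) by (cases i) (auto simp: row_of_Suc not_less)
  have "[] \<notin> set xs" unfolding xs_def by (auto dest: set_takeWhileD)
  then have "is_ssyt xs"
    unfolding is_ssyt_iff row using assms by blast
  then have "row (Abs_ssyt xs) i = f i" for i
    by (simp add: row.rep_eq Abs_ssyt_inverse row)
  then show ?thesis using that by blast
qed

lemma fits_take: "fits r s \<Longrightarrow> fits (take k r) (take k s)"
  by (auto simp: fits_def)

lemma fits_drop: "fits r s \<Longrightarrow> fits (drop k r) (drop k s)"
  by (auto simp: fits_def)

lemma one_column_iff_row:
  "C \<in> one_column n m \<longleftrightarrow> C \<in> SSYT n m \<and> row C 1 \<noteq> [] \<and> (\<forall>i. length (row C i) \<le> 1)"
proof -
  have ne: "[] \<notin> set (rows C)" using rows[of C] by (simp add: is_ssyt_def)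
  have "(\<forall>r\<in>set (rows C). length r = 1) \<longleftrightarrow> (\<forall>i. length (row C i) \<le> 1)"
  proof
    assume *: "\<forall>i. length (row C i) \<le> 1"
    show "\<forall>r\<in>set (rows C). length r = 1"
    proof
      fix r assume r: "r \<in> set (rows C)"
      then obtain i where "i < length (rows C)" "r = rows C ! i" by (auto simp: in_set_conv_nth)
      then have "r = row C (Suc i)" by (simp add: row.rep_eq row_of_Suc)
      then have "length r \<le> 1" using * by simp
      moreover have "r \<noteq> []" using r ne by metis
      ultimately show "length r = 1" by (cases r) auto
    qed
  qed (auto simp: row.rep_eq row_of_def)
  moreover have "rows C \<noteq> [] \<longleftrightarrow> row C 1 \<noteq> []"
    using ne by (cases "rows C") (auto simp: row.rep_eq row_of_def)
  ultimately show ?thesis by (auto simp: one_column_def)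
qed

text \<open>The first column splits off: \<open>T\<close> is the product of the tableau formed by the first entries of the
rows and the tableau formed by the remaining entries.\<close>

lemma SSYT_generated_by_columns: "SSYT n m \<subseteq> sums_of (one_column n m)"
proof
  fix T assume "T \<in> SSYT n m"
  then show "T \<in> sums_of (one_column n m)"
  proof (induction "length (row T 1)" arbitrary: T rule: less_induct)
    case (less T)
    note T = less.prems[unfolded SSYT_iff_row]
    show ?case
    proof (cases "row T 1 = []")
      case True
      then have "row T i = []" for i
        using row_antimono[of 0 "i - 1" T] by (cases i) auto
      then have "T = 0" by (intro ssyt_eqI) simp
      then show ?thesis by (simp add: sums_of.zero)
    next
      case False
      obtain C where C: "\<And>i. row C i = take 1 (row T i)"
        by (rule ssyt_of_rows[of "\<lambda>i. take 1 (row T i)" n])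
          (use T in \<open>auto simp: fits_take fits_rows sorted_row zero_notin_row dest: in_set_takeD
             intro: sorted_wrt_take\<close>)
      obtain U where U: "\<And>i. row U i = drop 1 (row T i)"
        by (rule ssyt_of_rows[of "\<lambda>i. drop 1 (row T i)" n])
          (use T in \<open>auto simp: fits_drop fits_rows sorted_row zero_notin_row dest: in_set_dropD
             intro: sorted_wrt_drop\<close>)
      have TCU: "T = C + U"
        by (rule ssyt_eqI) (simp add: row_plus C U sorted_sort_id sorted_row del: One_nat_def)
      have "C \<in> one_column n m"
        using T False unfolding one_column_iff_row SSYT_iff_row C by (auto dest: in_set_takeD)
      moreover have "U \<in> SSYT n m"
        using T unfolding SSYT_iff_row U by (auto dest: in_set_dropD)
      then have "U \<in> sums_of (one_column n m)"
        using less.hyps[of U] False by (simp add: U)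
      ultimately show ?thesis unfolding TCU by (rule sums_of.plus)
    qed
  qed
qed

section \<open>Contraction along the tableaux monomial map\<close>

lemma wt_plus: "wt (T + U) i j = wt T i j + wt U i j"
proof -
  have "count_list (sort xs) j = count_list xs j" for xs
    by (metis count_mset mset_sort)
  then show ?thesis by (simp add: wt_def row_plus)
qed

lemma ev_tableau_plus: "ev_tableau n m \<alpha> (T + U) = ev_tableau n m \<alpha> T * ev_tableau n m \<alpha> U"
  by (simp add: ev_tableau_def wt_plus power_add prod.distrib)

lemma ev_tableau_zero: "ev_tableau n m \<alpha> 0 = 1"
  by (simp add: ev_tableau_def wt_def)

lemma tableaux_algebra_character:
  "field_character (SSYT n m) (one_column n m) (ev_tableau n m \<alpha>)"
  by (intro field_character.intro algebra_character.intro SSYT_zero SSYT_plus SSYT_generated_by_columns)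
    (auto simp: one_column_def ev_tableau_plus ev_tableau_zero)

text \<open>Evaluation at \<open>\<alpha>\<close> is a character of the monoid of tableaux, and \<open>\<Psi>(\<alpha>)\<close> lists its values on the
one-column tableaux, which generate that monoid.\<close>

lemma M_ideal_Psi:
  fixes \<alpha> :: "nat \<Rightarrow> nat \<Rightarrow> 'k::field"
  shows "M_ideal n m (Psi n m \<alpha>) = {p \<in> carrier (tableaux_algebra n m). lin_ext (ev_tableau n m \<alpha>) p = 0}"
    and "maximalideal (M_ideal n m (Psi n m \<alpha>)) (tableaux_algebra n m)"
proof -
  interpret field_character "SSYT n m" "one_column n m" "ev_tableau n m \<alpha>"
    by (rule tableaux_algebra_character)
  have "{Poly_Mapping.single T 1 - const (Psi n m \<alpha> T) | T. T \<in> one_column n m} =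
    {Poly_Mapping.single g 1 - const (ev_tableau n m \<alpha> g) | g. g \<in> one_column n m}"
    by (auto simp: Psi_def)
  then have M: "M_ideal n m (Psi n m \<alpha>) = Ker"
    unfolding M_ideal_def tableaux_algebra_def by (simp only: genideal_eq_Ker)
  show "M_ideal n m (Psi n m \<alpha>) = {p \<in> carrier (tableaux_algebra n m). lin_ext (ev_tableau n m \<alpha>) p = 0}"
    unfolding M tableaux_algebra_def Ker_def ..
  show "maximalideal (M_ideal n m (Psi n m \<alpha>)) (tableaux_algebra n m)"
    unfolding M tableaux_algebra_def by (rule maximalideal_Ker)
qed

definition tableau_monomial :: "nat \<Rightarrow> nat \<Rightarrow> ssyt \<Rightarrow> (nat \<times> nat \<Rightarrow>\<^sub>0 nat)" where
  "tableau_monomial n m T = (\<Sum>(i, j)\<in>{1..n} \<times> {1..m}. Poly_Mapping.single (i, j) (wt T i j))"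

lemma lookup_tableau_monomial:
  "Poly_Mapping.lookup (tableau_monomial n m T) (i, j) = (if (i, j) \<in> {1..n} \<times> {1..m} then wt T i j else 0)"
proof -
  have "Poly_Mapping.lookup (tableau_monomial n m T) (i, j) =
    (\<Sum>v\<in>{1..n} \<times> {1..m}. if v = (i, j) then wt T i j else 0)"
    unfolding tableau_monomial_def lookup_sum
    by (intro sum.cong) (auto simp: lookup_single when_def split: prod.splits)
  then show ?thesis by (simp add: sum.delta)
qed

text \<open>The algebra homomorphism from the tableaux algebra to the polynomial ring that sends \<open>T\<close> to its
monomial.\<close>

definition tableau_poly :: "nat \<Rightarrow> nat \<Rightarrow> (ssyt \<Rightarrow>\<^sub>0 'k) \<Rightarrow> ((nat \<times> nat \<Rightarrow>\<^sub>0 nat) \<Rightarrow>\<^sub>0 'k::comm_ring_1)" where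
  "tableau_poly n m p =
    (\<Sum>T\<in>Poly_Mapping.keys p. Poly_Mapping.single (tableau_monomial n m T) (Poly_Mapping.lookup p T))"

lemma tableau_poly_value:
  "lin_ext (monomial_value n m \<alpha>) (tableau_poly n m p) = lin_ext (ev_tableau n m \<alpha>) p"
proof -
  have "monomial_value n m \<alpha> (tableau_monomial n m T) = ev_tableau n m \<alpha> T" for T
    unfolding monomial_value_def ev_tableau_def
    by (intro prod.cong refl) (simp add: lookup_tableau_monomial)
  then show ?thesis by (simp add: tableau_poly_def lin_ext_sum) (simp add: lin_ext_def)
qed

lemma tableau_poly_in_poly_ring: "tableau_poly n m p \<in> carrier (poly_ring n m)"
proof -
  note A = unital_subringD[OF unital_subring_polys_in]
  have "Poly_Mapping.keys (tableau_monomial n m T) \<subseteq> {1..n} \<times> {1..m}" for T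
    by (auto simp: in_keys_iff lookup_tableau_monomial split: if_splits)
  then have "tableau_poly n m p \<in> polys_in ({1..n} \<times> {1..m})"
    unfolding tableau_poly_def by (intro A(8)) (auto simp: polys_in_def in_carrier_monoid_algebra)
  then show ?thesis by (simp add: polys_in_def poly_ring_def)
qed

text \<open>The inverse image of the zero locus of an ideal \<open>I\<close> is the zero locus of the ideal generated by the
image of \<open>I\<close> in the polynomial ring.\<close>

theorem corollary3p20:
  fixes n m :: nat
  assumes "1 \<le> n" and "n \<le> m"
  shows "continuous_map
           (zariski (poly_ring n m :: ((nat \<times> nat \<Rightarrow>\<^sub>0 nat) \<Rightarrow>\<^sub>0 'k::{alg_closed_field, field_char_0}) ring))
           (zariski (tableaux_algebra n m))
           (Psi_star n m)"
proof -
  let ?P = "poly_ring n m :: ((nat \<times> nat \<Rightarrow>\<^sub>0 nat) \<Rightarrow>\<^sub>0 'k) ring"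
  let ?T = "tableaux_algebra n m :: (ssyt \<Rightarrow>\<^sub>0 'k) ring"
  interpret P: cring ?P by (rule cring_poly_ring)
  have mem: "Psi_star n m N \<in> maxSpec ?T" if "N \<in> maxSpec ?P" for N
    using that weak_nullstellensatz M_ideal_Psi(2) unfolding maxSpec_def
    by (metis Psi_star_N_ideal mem_Collect_eq)
  have "openin (zariski ?P) {N \<in> maxSpec ?P. Psi_star n m N \<in> U}" if U: "openin (zariski ?T) U" for U
  proof -
    obtain I where I: "ideal I ?T" "U = maxSpec ?T - zero_locus ?T I"
      using U by (auto simp: openin_zariski[OF cring_tableaux_algebra])
    have IT: "I \<subseteq> carrier ?T" using I(1) by (auto intro: ideal.Icarr)
    let ?F = "tableau_poly n m ` I"
    have F: "?F \<subseteq> carrier ?P" using tableau_poly_in_poly_ring by blast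
    have "I \<subseteq> Psi_star n m N \<longleftrightarrow> genideal ?P ?F \<subseteq> N" if N: "N \<in> maxSpec ?P" for N
    proof -
      obtain \<alpha> where \<alpha>: "N = N_ideal n m \<alpha>" using weak_nullstellensatz[of N n m] N by (auto simp: maxSpec_def)
      have "I \<subseteq> Psi_star n m N \<longleftrightarrow> (\<forall>p\<in>I. lin_ext (ev_tableau n m \<alpha>) p = 0)"
        using IT unfolding \<alpha> Psi_star_N_ideal M_ideal_Psi(1) by blast
      also have "\<dots> \<longleftrightarrow> ?F \<subseteq> N"
        unfolding \<alpha> N_ideal_eq_kernel by (auto simp: tableau_poly_value tableau_poly_in_poly_ring)
      also have "\<dots> \<longleftrightarrow> genideal ?P ?F \<subseteq> N"
        using P.genideal_minimal[of N ?F] P.genideal_self[OF F] N maximalideal.axioms(1)[of N ?P]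
        by (auto simp: maxSpec_def)
      finally show ?thesis .
    qed
    then have "{N \<in> maxSpec ?P. Psi_star n m N \<in> U} = maxSpec ?P - zero_locus ?P (genideal ?P ?F)"
      using mem unfolding I(2) zero_locus_def by blast
    then show ?thesis
      using P.genideal_ideal[OF F] by (auto simp: openin_zariski[OF cring_poly_ring])
  qed
  then show ?thesis
    using mem unfolding continuous_map_def topspace_zariski[OF cring_poly_ring]
      topspace_zariski[OF cring_tableaux_algebra] by blast
qed

end
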